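(* Let $I=\mathbb{2}$, and let $\mathcal{A}$ be the $2$-category generated by objects $X,A,B$; morphisms $\alpha_0,\alpha_1\colon X\to A$ and $f\colon A\to B$; and an invertible $2$-morphism $\alpha\colon\alpha_0\Rightarrow\alpha_1$; subject to the relations $f\alpha_0=f\alpha_1$ and $f*\alpha=\mathrm{id}_{f\alpha_0}$. Consider the $2$-functor $f\colon\mathbb{2}\to\mathcal{A}$ given by the morphism $f\colon A\to B$, and let $\mathrm{id}_f\colon\Delta A\Rightarrow f$ be the cone with components $\mathrm{id}_A\colon A\to A$ and $f\colon A\to B$ and with $2$-morphism component $\mathrm{id}_f$. Then $(A,\mathrm{id}_f)$ is a lax-limit (resp. pseudo-limit) of $f$ which is not $2$-terminal in the pseudo-slice of lax-cones (resp. pseudo-cones) over $f$.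
   Context: $\mathbb{2}$ is the category $\{0\to1\}$, regarded as a $2$-category with only identity $2$-morphisms. $2$-categories and $2$-functors are strict; $*$ denotes horizontal composition (and whiskering) of $2$-morphisms and juxtaposition denotes vertical composition. "Generated by the data subject to relations" means the $2$-category freely generated by the listed objects, morphisms and $2$-morphisms (with a formal inverse adjoined for each $2$-morphism declared invertible), modulo the listed relations. A lax-natural transformation $\mu\colon F\Rightarrow G$ between $2$-functors $F,G\colon I\to\mathcal{A}$ consists of morphisms $\mu_i\colon Fi\to Gi$ for $i\in I$ and $2$-morphisms $\mu_f\colon(Gf)\mu_i\Rightarrow\mu_j(Ff)$ for $f\colon i\to j$ in $I$, such that $\mu_{\mathrm{id}_i}=\mathrm{id}_{\mu_i}$, $\mu_{gf}=(\mu_g*Ff)(Gg*\mu_f)$ for composable $f,g$, and $\mu_g(G\alpha*\mu_i)=(\mu_j*F\alpha)\mu_f$ for every $2$-morphism $\alpha\colon f\Rightarrow g$ in $I$. It is pseudo-natural if every $\mu_f$ is invertible. A modification $\varphi\colon\mu\to\nu$ consists of $2$-morphisms $\varphi_i\colon\mu_i\Rightarrow\nu_i$ with $\nu_f(Gf*\varphi_i)=(\varphi_j*Ff)\mu_f$ for every $f\colon i\to j$. $\mathrm{Lax}[I,\mathcal{A}]$ (resp. $\mathrm{Ps}[I,\mathcal{A}]$) is the $2$-category of $2$-functors, lax- (resp. pseudo-) natural transformations and modifications. $\Delta X$ is the constant $2$-functor at $X$; a lax-cone (resp. pseudo-cone) over $F$ is a lax- (resp. pseudo-) natural transformation $\Delta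 X\Rightarrow F$. A lax-limit (resp. pseudo-limit) of $F$ is a pair $(L,\lambda)$ with $\lambda\colon\Delta L\Rightarrow F$ a lax-cone (resp. pseudo-cone) such that for each $X\in\mathcal{A}$ the functor $\lambda_*\circ\Delta\colon\mathcal{A}(X,L)\to\mathrm{Lax}[I,\mathcal{A}](\Delta X,F)$ (resp. $\mathcal{A}(X,L)\to\mathrm{Ps}[I,\mathcal{A}](\Delta X,F)$), given by post-composition with $\lambda$, is an isomorphism of categories. The pseudo-slice of lax-cones (resp. pseudo-cones) over $F$ is the $2$-category whose objects are pairs $(X,\mu)$ with $\mu\colon\Delta X\Rightarrow F$ a lax-cone (resp. pseudo-cone); morphisms $(X,\mu)\to(Y,\nu)$ are pairs $(h,\varphi)$ of a morphism $h\colon X\to Y$ in $\mathcal{A}$ and an invertible modification $\varphi\colon\nu\Delta h\to\mu$; $2$-morphisms $(h,\varphi)\Rightarrow(k,\psi)$ are $2$-morphisms $\beta\colon h\Rightarrow k$ in $\mathcal{A}$ with $\psi(\nu*\Delta\beta)=\varphi$. An object $L$ of a $2$-category $\mathcal{B}$ is $2$-terminal if for all $X\in\mathcal{B}$ the category $\mathcal{B}(X,L)$ is isomorphic to the terminal category $\mathbb{1}$. *)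

theory Defs
  imports "HOL-Library.FuncSet"
begin

section \<open>Categories\<close>

record ('o, 'a) cat =
  cOb :: "'o set"
  cArr :: "'a set"
  cdom :: "'a \<Rightarrow> 'o"
  ccod :: "'a \<Rightarrow> 'o"
  cid :: "'o \<Rightarrow> 'a"
  ccmp :: "'a \<Rightarrow> 'a \<Rightarrow> 'a"  \<comment> \<open>\<open>ccmp C g f\<close> is \<open>g\<close> after \<open>f\<close>\<close>

locale category =
  fixes C :: "('o, 'a) cat"
  assumes dom_ob: "f \<in> cArr C \<Longrightarrow> cdom C f \<in> cOb C"
    and cod_ob: "f \<in> cArr C \<Longrightarrow> ccod C f \<in> cOb C"
    and id_arr: "x \<in> cOb C \<Longrightarrow> cid C x \<in> cArr C"
    and dom_id: "x \<in> cOb C \<Longrightarrow> cdom C (cid C x) = x"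
    and cod_id: "x \<in> cOb C \<Longrightarrow> ccod C (cid C x) = x"
    and cmp_arr: "\<lbrakk>g \<in> cArr C; f \<in> cArr C; cdom C g = ccod C f\<rbrakk> \<Longrightarrow> ccmp C g f \<in> cArr C"
    and dom_cmp: "\<lbrakk>g \<in> cArr C; f \<in> cArr C; cdom C g = ccod C f\<rbrakk> \<Longrightarrow> cdom C (ccmp C g f) = cdom C f"
    and cod_cmp: "\<lbrakk>g \<in> cArr C; f \<in> cArr C; cdom C g = ccod C f\<rbrakk> \<Longrightarrow> ccod C (ccmp C g f) = ccod C g"
    and cmp_id_left: "f \<in> cArr C \<Longrightarrow> ccmp C (cid C (ccod C f)) f = f"
    and cmp_id_right: "f \<in> cArr C \<Longrightarrow> ccmp C f (cid C (cdom C f)) = f"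
    and cmp_assoc: "\<lbrakk>h \<in> cArr C; g \<in> cArr C; f \<in> cArr C; cdom C h = ccod C g; cdom C g = ccod C f\<rbrakk>
      \<Longrightarrow> ccmp C (ccmp C h g) f = ccmp C h (ccmp C g f)"

locale cat_functor = C: category C + D: category D
  for C :: "('o, 'a) cat" and D :: "('p, 'b) cat" +
  fixes G0 :: "'o \<Rightarrow> 'p" and G1 :: "'a \<Rightarrow> 'b"
  assumes map_ob: "x \<in> cOb C \<Longrightarrow> G0 x \<in> cOb D"
    and map_arr: "f \<in> cArr C \<Longrightarrow> G1 f \<in> cArr D"
    and map_dom: "f \<in> cArr C \<Longrightarrow> cdom D (G1 f) = G0 (cdom C f)"
    and map_cod: "f \<in> cArr C \<Longrightarrow> ccod D (G1 f) = G0 (ccod C f)"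
    and map_id: "x \<in> cOb C \<Longrightarrow> G1 (cid C x) = cid D (G0 x)"
    and map_cmp: "\<lbrakk>g \<in> cArr C; f \<in> cArr C; cdom C g = ccod C f\<rbrakk>
      \<Longrightarrow> G1 (ccmp C g f) = ccmp D (G1 g) (G1 f)"

definition iso_functor ::
  "('o, 'a) cat \<Rightarrow> ('p, 'b) cat \<Rightarrow> ('o \<Rightarrow> 'p) \<Rightarrow> ('a \<Rightarrow> 'b) \<Rightarrow> bool" where
  "iso_functor C D G0 G1 \<longleftrightarrow> cat_functor C D G0 G1 \<and>
    (\<exists>H0 H1. cat_functor D C H0 H1 \<and>
      (\<forall>x\<in>cOb C. H0 (G0 x) = x) \<and> (\<forall>f\<in>cArr C. H1 (G1 f) = f) \<and>
      (\<forall>y\<in>cOb D. G0 (H0 y) = y) \<and> (\<forall>g\<in>cArr D. G1 (H1 g) = g))"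

definition isomorphic_cat :: "('o, 'a) cat \<Rightarrow> ('p, 'b) cat \<Rightarrow> bool" where
  "isomorphic_cat C D \<longleftrightarrow> (\<exists>G0 G1. iso_functor C D G0 G1)"

definition terminal_cat :: "(unit, unit) cat" where
  "terminal_cat = \<lparr> cOb = UNIV, cArr = UNIV, cdom = (\<lambda>_. ()), ccod = (\<lambda>_. ()),
     cid = (\<lambda>_. ()), ccmp = (\<lambda>_ _. ()) \<rparr>"

text \<open>The category \<open>0 \<rightarrow> 1\<close>; the arrow from \<open>i\<close> to \<open>j\<close> is the pair \<open>(i, j)\<close>.\<close>

definition arrow_cat :: "(nat, nat \<times> nat) cat" where
  "arrow_cat = \<lparr> cOb = {0, 1}, cArr = {(0, 0), (0, 1), (1, 1)}, cdom = fst, ccod = snd,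
     cid = (\<lambda>i. (i, i)), ccmp = (\<lambda>g f. (fst f, snd g)) \<rparr>"


section \<open>Strict 2-categories\<close>

record ('o, 'm, 'c) two_cat =
  Obj :: "'o set"
  Mor :: "'m set"
  Cell :: "'c set"
  src :: "'m \<Rightarrow> 'o"
  tgt :: "'m \<Rightarrow> 'o"
  src2 :: "'c \<Rightarrow> 'm"
  tgt2 :: "'c \<Rightarrow> 'm"
  id1 :: "'o \<Rightarrow> 'm"
  cmp1 :: "'m \<Rightarrow> 'm \<Rightarrow> 'm"  \<comment> \<open>\<open>cmp1 A g f\<close> is \<open>g\<close> after \<open>f\<close>\<close>
  id2 :: "'m \<Rightarrow> 'c"
  vcmp :: "'c \<Rightarrow> 'c \<Rightarrow> 'c"  \<comment> \<open>\<open>vcmp A b a\<close> is \<open>b\<close> after \<open>a\<close>, written \<open>b a\<close> by juxtaposition\<close>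
  hcmp :: "'c \<Rightarrow> 'c \<Rightarrow> 'c"  \<comment> \<open>\<open>hcmp A b a\<close> is \<open>b * a\<close>, with \<open>b\<close> on the outer side\<close>

locale two_category =
  fixes A :: "('o, 'm, 'c) two_cat"
  assumes src_ob: "f \<in> Mor A \<Longrightarrow> src A f \<in> Obj A"
    and tgt_ob: "f \<in> Mor A \<Longrightarrow> tgt A f \<in> Obj A"
    and id1_mor: "x \<in> Obj A \<Longrightarrow> id1 A x \<in> Mor A"
    and src_id1: "x \<in> Obj A \<Longrightarrow> src A (id1 A x) = x"
    and tgt_id1: "x \<in> Obj A \<Longrightarrow> tgt A (id1 A x) = x"
    and cmp1_mor: "\<lbrakk>g \<in> Mor A; f \<in> Mor A; src A g = tgt A f\<rbrakk> \<Longrightarrow> cmp1 A g f \<in> Mor A"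
    and src_cmp1: "\<lbrakk>g \<in> Mor A; f \<in> Mor A; src A g = tgt A f\<rbrakk> \<Longrightarrow> src A (cmp1 A g f) = src A f"
    and tgt_cmp1: "\<lbrakk>g \<in> Mor A; f \<in> Mor A; src A g = tgt A f\<rbrakk> \<Longrightarrow> tgt A (cmp1 A g f) = tgt A g"
    and cmp1_id_left: "f \<in> Mor A \<Longrightarrow> cmp1 A (id1 A (tgt A f)) f = f"
    and cmp1_id_right: "f \<in> Mor A \<Longrightarrow> cmp1 A f (id1 A (src A f)) = f"
    and cmp1_assoc: "\<lbrakk>h \<in> Mor A; g \<in> Mor A; f \<in> Mor A; src A h = tgt A g; src A g = tgt A f\<rbrakk>
      \<Longrightarrow> cmp1 A (cmp1 A h g) f = cmp1 A h (cmp1 A g f)"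
    and src2_mor: "a \<in> Cell A \<Longrightarrow> src2 A a \<in> Mor A"
    and tgt2_mor: "a \<in> Cell A \<Longrightarrow> tgt2 A a \<in> Mor A"
    and src_tgt2: "a \<in> Cell A \<Longrightarrow> src A (tgt2 A a) = src A (src2 A a)"
    and tgt_tgt2: "a \<in> Cell A \<Longrightarrow> tgt A (tgt2 A a) = tgt A (src2 A a)"
    and id2_cell: "f \<in> Mor A \<Longrightarrow> id2 A f \<in> Cell A"
    and src2_id2: "f \<in> Mor A \<Longrightarrow> src2 A (id2 A f) = f"
    and tgt2_id2: "f \<in> Mor A \<Longrightarrow> tgt2 A (id2 A f) = f"
    and vcmp_cell: "\<lbrakk>b \<in> Cell A; a \<in> Cell A; src2 A b = tgt2 A a\<rbrakk> \<Longrightarrow> vcmp A b a \<in> Cell A"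
    and src2_vcmp: "\<lbrakk>b \<in> Cell A; a \<in> Cell A; src2 A b = tgt2 A a\<rbrakk> \<Longrightarrow> src2 A (vcmp A b a) = src2 A a"
    and tgt2_vcmp: "\<lbrakk>b \<in> Cell A; a \<in> Cell A; src2 A b = tgt2 A a\<rbrakk> \<Longrightarrow> tgt2 A (vcmp A b a) = tgt2 A b"
    and vcmp_id_left: "a \<in> Cell A \<Longrightarrow> vcmp A (id2 A (tgt2 A a)) a = a"
    and vcmp_id_right: "a \<in> Cell A \<Longrightarrow> vcmp A a (id2 A (src2 A a)) = a"
    and vcmp_assoc: "\<lbrakk>c \<in> Cell A; b \<in> Cell A; a \<in> Cell A; src2 A c = tgt2 A b; src2 A b = tgt2 A a\<rbrakk>
      \<Longrightarrow> vcmp A (vcmp A c b) a = vcmp A c (vcmp A b a)"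
    and hcmp_cell: "\<lbrakk>b \<in> Cell A; a \<in> Cell A; src A (src2 A b) = tgt A (src2 A a)\<rbrakk> \<Longrightarrow> hcmp A b a \<in> Cell A"
    and src2_hcmp: "\<lbrakk>b \<in> Cell A; a \<in> Cell A; src A (src2 A b) = tgt A (src2 A a)\<rbrakk>
      \<Longrightarrow> src2 A (hcmp A b a) = cmp1 A (src2 A b) (src2 A a)"
    and tgt2_hcmp: "\<lbrakk>b \<in> Cell A; a \<in> Cell A; src A (src2 A b) = tgt A (src2 A a)\<rbrakk>
      \<Longrightarrow> tgt2 A (hcmp A b a) = cmp1 A (tgt2 A b) (tgt2 A a)"
    and hcmp_id_left: "a \<in> Cell A \<Longrightarrow> hcmp A (id2 A (id1 A (tgt A (src2 A a)))) a = a"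
    and hcmp_id_right: "a \<in> Cell A \<Longrightarrow> hcmp A a (id2 A (id1 A (src A (src2 A a)))) = a"
    and hcmp_assoc: "\<lbrakk>c \<in> Cell A; b \<in> Cell A; a \<in> Cell A;
        src A (src2 A c) = tgt A (src2 A b); src A (src2 A b) = tgt A (src2 A a)\<rbrakk>
      \<Longrightarrow> hcmp A (hcmp A c b) a = hcmp A c (hcmp A b a)"
    and hcmp_id2: "\<lbrakk>g \<in> Mor A; f \<in> Mor A; src A g = tgt A f\<rbrakk>
      \<Longrightarrow> hcmp A (id2 A g) (id2 A f) = id2 A (cmp1 A g f)"
    and interchange: "\<lbrakk>b' \<in> Cell A; b \<in> Cell A; a' \<in> Cell A; a \<in> Cell A;
        src2 A b' = tgt2 A b; src2 A a' = tgt2 A a; src A (src2 A b) = tgt A (src2 A a)\<rbrakk>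
      \<Longrightarrow> hcmp A (vcmp A b' b) (vcmp A a' a) = vcmp A (hcmp A b' a') (hcmp A b a)"

definition invertible_cell :: "('o, 'm, 'c) two_cat \<Rightarrow> 'c \<Rightarrow> bool" where
  "invertible_cell A a \<longleftrightarrow> a \<in> Cell A \<and>
    (\<exists>b\<in>Cell A. src2 A b = tgt2 A a \<and> tgt2 A b = src2 A a \<and>
      vcmp A b a = id2 A (src2 A a) \<and> vcmp A a b = id2 A (tgt2 A a))"

definition hom_cat :: "('o, 'm, 'c) two_cat \<Rightarrow> 'o \<Rightarrow> 'o \<Rightarrow> ('m, 'c) cat" where
  "hom_cat A x y = \<lparr>
     cOb = {f \<in> Mor A. src A f = x \<and> tgt A f = y},
     cArr = {a \<in> Cell A. src A (src2 A a) = x \<and> tgt A (src2 A a) = y},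
     cdom = src2 A, ccod = tgt2 A, cid = id2 A, ccmp = vcmp A \<rparr>"

definition two_terminal :: "('o, 'm, 'c) two_cat \<Rightarrow> 'o \<Rightarrow> bool" where
  "two_terminal B l \<longleftrightarrow> l \<in> Obj B \<and> (\<forall>x\<in>Obj B. isomorphic_cat (hom_cat B x l) terminal_cat)"

text \<open>A category as a 2-category with only identity 2-morphisms; the identity of \<open>f\<close> is \<open>f\<close>.\<close>

definition locally_discrete :: "('o, 'a) cat \<Rightarrow> ('o, 'a, 'a) two_cat" where
  "locally_discrete C = \<lparr> Obj = cOb C, Mor = cArr C, Cell = cArr C,
     src = cdom C, tgt = ccod C, src2 = (\<lambda>f. f), tgt2 = (\<lambda>f. f),
     id1 = cid C, cmp1 = ccmp C, id2 = (\<lambda>f. f), vcmp = (\<lambda>g f. f), hcmp = ccmp C \<rparr>"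

definition two :: "(nat, nat \<times> nat, nat \<times> nat) two_cat" where
  "two = locally_discrete arrow_cat"


section \<open>2-functors, lax-natural transformations, modifications\<close>

text \<open>
  Families indexed by the objects, morphisms or 2-morphisms of a 2-category are functions that are
  \<^const>\<open>extensional\<close> on the respective carrier, so that equality in HOL is equality of families.
\<close>

record ('i, 'f, 'x, 'o, 'm, 'c) two_fun =
  fob :: "'i \<Rightarrow> 'o"
  fmor :: "'f \<Rightarrow> 'm"
  fcell :: "'x \<Rightarrow> 'c"

locale two_functor = I: two_category I + A: two_category A
  for I :: "('i, 'f, 'x) two_cat" and A :: "('o, 'm, 'c) two_cat" +
  fixes F :: "('i, 'f, 'x, 'o, 'm, 'c) two_fun"
  assumes fob_ext: "fob F \<in> extensional (Obj I)"
    and fmor_ext: "fmor F \<in> extensional (Mor I)"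
    and fcell_ext: "fcell F \<in> extensional (Cell I)"
    and fob_ob: "i \<in> Obj I \<Longrightarrow> fob F i \<in> Obj A"
    and fmor_mor: "f \<in> Mor I \<Longrightarrow> fmor F f \<in> Mor A"
    and src_fmor: "f \<in> Mor I \<Longrightarrow> src A (fmor F f) = fob F (src I f)"
    and tgt_fmor: "f \<in> Mor I \<Longrightarrow> tgt A (fmor F f) = fob F (tgt I f)"
    and fcell_cell: "a \<in> Cell I \<Longrightarrow> fcell F a \<in> Cell A"
    and src2_fcell: "a \<in> Cell I \<Longrightarrow> src2 A (fcell F a) = fmor F (src2 I a)"
    and tgt2_fcell: "a \<in> Cell I \<Longrightarrow> tgt2 A (fcell F a) = fmor F (tgt2 I a)"
    and fmor_id1: "i \<in> Obj I \<Longrightarrow> fmor F (id1 I i) = id1 A (fob F i)"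
    and fmor_cmp1: "\<lbrakk>g \<in> Mor I; f \<in> Mor I; src I g = tgt I f\<rbrakk>
      \<Longrightarrow> fmor F (cmp1 I g f) = cmp1 A (fmor F g) (fmor F f)"
    and fcell_id2: "f \<in> Mor I \<Longrightarrow> fcell F (id2 I f) = id2 A (fmor F f)"
    and fcell_vcmp: "\<lbrakk>b \<in> Cell I; a \<in> Cell I; src2 I b = tgt2 I a\<rbrakk>
      \<Longrightarrow> fcell F (vcmp I b a) = vcmp A (fcell F b) (fcell F a)"
    and fcell_hcmp: "\<lbrakk>b \<in> Cell I; a \<in> Cell I; src I (src2 I b) = tgt I (src2 I a)\<rbrakk>
      \<Longrightarrow> fcell F (hcmp I b a) = hcmp A (fcell F b) (fcell F a)"

record ('i, 'f, 'x, 'o, 'm, 'c) trans =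
  tsrc :: "('i, 'f, 'x, 'o, 'm, 'c) two_fun"
  ttgt :: "('i, 'f, 'x, 'o, 'm, 'c) two_fun"
  tob :: "'i \<Rightarrow> 'm"
  tmor :: "'f \<Rightarrow> 'c"

locale lax_natural = F: two_functor I A "tsrc \<mu>" + G: two_functor I A "ttgt \<mu>"
  for I :: "('i, 'f, 'x) two_cat" and A :: "('o, 'm, 'c) two_cat"
    and \<mu> :: "('i, 'f, 'x, 'o, 'm, 'c) trans" +
  assumes tob_ext: "tob \<mu> \<in> extensional (Obj I)"
    and tmor_ext: "tmor \<mu> \<in> extensional (Mor I)"
    and tob_mor: "i \<in> Obj I \<Longrightarrow> tob \<mu> i \<in> Mor A"
    and src_tob: "i \<in> Obj I \<Longrightarrow> src A (tob \<mu> i) = fob (tsrc \<mu>) i"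
    and tgt_tob: "i \<in> Obj I \<Longrightarrow> tgt A (tob \<mu> i) = fob (ttgt \<mu>) i"
    and tmor_cell: "f \<in> Mor I \<Longrightarrow> tmor \<mu> f \<in> Cell A"
    and src2_tmor: "f \<in> Mor I \<Longrightarrow> src2 A (tmor \<mu> f) = cmp1 A (fmor (ttgt \<mu>) f) (tob \<mu> (src I f))"
    and tgt2_tmor: "f \<in> Mor I \<Longrightarrow> tgt2 A (tmor \<mu> f) = cmp1 A (tob \<mu> (tgt I f)) (fmor (tsrc \<mu>) f)"
    and tmor_id1: "i \<in> Obj I \<Longrightarrow> tmor \<mu> (id1 I i) = id2 A (tob \<mu> i)"
    and tmor_cmp1: "\<lbrakk>g \<in> Mor I; f \<in> Mor I; src I g = tgt I f\<rbrakk> \<Longrightarrow>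
      tmor \<mu> (cmp1 I g f) =
        vcmp A (hcmp A (tmor \<mu> g) (id2 A (fmor (tsrc \<mu>) f)))
               (hcmp A (id2 A (fmor (ttgt \<mu>) g)) (tmor \<mu> f))"
    and tmor_nat: "a \<in> Cell I \<Longrightarrow>
      vcmp A (tmor \<mu> (tgt2 I a))
             (hcmp A (fcell (ttgt \<mu>) a) (id2 A (tob \<mu> (src I (src2 I a))))) =
      vcmp A (hcmp A (id2 A (tob \<mu> (tgt I (src2 I a)))) (fcell (tsrc \<mu>) a))
             (tmor \<mu> (src2 I a))"

definition pseudo_natural ::
  "('i, 'f, 'x) two_cat \<Rightarrow> ('o, 'm, 'c) two_cat \<Rightarrow> ('i, 'f, 'x, 'o, 'm, 'c) trans \<Rightarrow> bool" where
  "pseudo_natural I A \<mu> \<longleftrightarrow> lax_natural I A \<mu> \<and> (\<forall>f\<in>Mor I. invertible_cell A (tmor \<mu> f))"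

record ('i, 'f, 'x, 'o, 'm, 'c) modif =
  msrc :: "('i, 'f, 'x, 'o, 'm, 'c) trans"
  mtgt :: "('i, 'f, 'x, 'o, 'm, 'c) trans"
  mob :: "'i \<Rightarrow> 'c"

locale modification = S: lax_natural I A "msrc \<phi>" + T: lax_natural I A "mtgt \<phi>"
  for I :: "('i, 'f, 'x) two_cat" and A :: "('o, 'm, 'c) two_cat"
    and \<phi> :: "('i, 'f, 'x, 'o, 'm, 'c) modif" +
  assumes tsrc_eq: "tsrc (mtgt \<phi>) = tsrc (msrc \<phi>)"
    and ttgt_eq: "ttgt (mtgt \<phi>) = ttgt (msrc \<phi>)"
    and mob_ext: "mob \<phi> \<in> extensional (Obj I)"
    and mob_cell: "i \<in> Obj I \<Longrightarrow> mob \<phi> i \<in> Cell A"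
    and src2_mob: "i \<in> Obj I \<Longrightarrow> src2 A (mob \<phi> i) = tob (msrc \<phi>) i"
    and tgt2_mob: "i \<in> Obj I \<Longrightarrow> tgt2 A (mob \<phi> i) = tob (mtgt \<phi>) i"
    and mob_nat: "f \<in> Mor I \<Longrightarrow>
      vcmp A (tmor (mtgt \<phi>) f)
             (hcmp A (id2 A (fmor (ttgt (msrc \<phi>)) f)) (mob \<phi> (src I f))) =
      vcmp A (hcmp A (mob \<phi> (tgt I f)) (id2 A (fmor (tsrc (msrc \<phi>)) f)))
             (tmor (msrc \<phi>) f)"


section \<open>The 2-categories of lax- and pseudo-natural transformations\<close>

definition trans_id ::
  "('i, 'f, 'x) two_cat \<Rightarrow> ('o, 'm, 'c) two_cat \<Rightarrow> ('i, 'f, 'x, 'o, 'm, 'c) two_fun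
    \<Rightarrow> ('i, 'f, 'x, 'o, 'm, 'c) trans" where
  "trans_id I A F = \<lparr> tsrc = F, ttgt = F,
     tob = (\<lambda>i\<in>Obj I. id1 A (fob F i)), tmor = (\<lambda>f\<in>Mor I. id2 A (fmor F f)) \<rparr>"

definition trans_cmp ::
  "('i, 'f, 'x) two_cat \<Rightarrow> ('o, 'm, 'c) two_cat \<Rightarrow> ('i, 'f, 'x, 'o, 'm, 'c) trans
    \<Rightarrow> ('i, 'f, 'x, 'o, 'm, 'c) trans \<Rightarrow> ('i, 'f, 'x, 'o, 'm, 'c) trans" where
  "trans_cmp I A \<nu> \<mu> = \<lparr> tsrc = tsrc \<mu>, ttgt = ttgt \<nu>,
     tob = (\<lambda>i\<in>Obj I. cmp1 A (tob \<nu> i) (tob \<mu> i)),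
     tmor = (\<lambda>f\<in>Mor I. vcmp A (hcmp A (id2 A (tob \<nu> (tgt I f))) (tmor \<mu> f))
                              (hcmp A (tmor \<nu> f) (id2 A (tob \<mu> (src I f))))) \<rparr>"

definition modif_id ::
  "('i, 'f, 'x) two_cat \<Rightarrow> ('o, 'm, 'c) two_cat \<Rightarrow> ('i, 'f, 'x, 'o, 'm, 'c) trans
    \<Rightarrow> ('i, 'f, 'x, 'o, 'm, 'c) modif" where
  "modif_id I A \<mu> = \<lparr> msrc = \<mu>, mtgt = \<mu>, mob = (\<lambda>i\<in>Obj I. id2 A (tob \<mu> i)) \<rparr>"

definition modif_vcmp ::
  "('i, 'f, 'x) two_cat \<Rightarrow> ('o, 'm, 'c) two_cat \<Rightarrow> ('i, 'f, 'x, 'o, 'm, 'c) modif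
    \<Rightarrow> ('i, 'f, 'x, 'o, 'm, 'c) modif \<Rightarrow> ('i, 'f, 'x, 'o, 'm, 'c) modif" where
  "modif_vcmp I A \<psi> \<phi> = \<lparr> msrc = msrc \<phi>, mtgt = mtgt \<psi>,
     mob = (\<lambda>i\<in>Obj I. vcmp A (mob \<psi> i) (mob \<phi> i)) \<rparr>"

definition modif_hcmp ::
  "('i, 'f, 'x) two_cat \<Rightarrow> ('o, 'm, 'c) two_cat \<Rightarrow> ('i, 'f, 'x, 'o, 'm, 'c) modif
    \<Rightarrow> ('i, 'f, 'x, 'o, 'm, 'c) modif \<Rightarrow> ('i, 'f, 'x, 'o, 'm, 'c) modif" where
  "modif_hcmp I A \<psi> \<phi> = \<lparr>
     msrc = trans_cmp I A (msrc \<psi>) (msrc \<phi>), mtgt = trans_cmp I A (mtgt \<psi>) (mtgt \<phi>),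
     mob = (\<lambda>i\<in>Obj I. hcmp A (mob \<psi> i) (mob \<phi> i)) \<rparr>"

type_synonym ('i, 'f, 'x, 'o, 'm, 'c) trans_two_cat =
  "(('i, 'f, 'x, 'o, 'm, 'c) two_fun, ('i, 'f, 'x, 'o, 'm, 'c) trans,
    ('i, 'f, 'x, 'o, 'm, 'c) modif) two_cat"

definition Lax ::
  "('i, 'f, 'x) two_cat \<Rightarrow> ('o, 'm, 'c) two_cat \<Rightarrow> ('i, 'f, 'x, 'o, 'm, 'c) trans_two_cat" where
  "Lax I A = \<lparr>
     Obj = {F. two_functor I A F}, Mor = {\<mu>. lax_natural I A \<mu>}, Cell = {\<phi>. modification I A \<phi>},
     src = tsrc, tgt = ttgt, src2 = msrc, tgt2 = mtgt,
     id1 = trans_id I A, cmp1 = trans_cmp I A,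
     id2 = modif_id I A, vcmp = modif_vcmp I A, hcmp = modif_hcmp I A \<rparr>"

definition Ps ::
  "('i, 'f, 'x) two_cat \<Rightarrow> ('o, 'm, 'c) two_cat \<Rightarrow> ('i, 'f, 'x, 'o, 'm, 'c) trans_two_cat" where
  "Ps I A = (Lax I A)\<lparr>
     Mor := {\<mu>. pseudo_natural I A \<mu>},
     Cell := {\<phi>. modification I A \<phi> \<and> pseudo_natural I A (msrc \<phi>) \<and> pseudo_natural I A (mtgt \<phi>)} \<rparr>"

text \<open>The diagonal 2-functor \<open>\<Delta>\<close> on objects, morphisms and 2-morphisms.\<close>

definition Delta_ob ::
  "('i, 'f, 'x) two_cat \<Rightarrow> ('o, 'm, 'c) two_cat \<Rightarrow> 'o \<Rightarrow> ('i, 'f, 'x, 'o, 'm, 'c) two_fun" where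
  "Delta_ob I A x = \<lparr> fob = (\<lambda>i\<in>Obj I. x), fmor = (\<lambda>f\<in>Mor I. id1 A x),
     fcell = (\<lambda>a\<in>Cell I. id2 A (id1 A x)) \<rparr>"

definition Delta_mor ::
  "('i, 'f, 'x) two_cat \<Rightarrow> ('o, 'm, 'c) two_cat \<Rightarrow> 'm \<Rightarrow> ('i, 'f, 'x, 'o, 'm, 'c) trans" where
  "Delta_mor I A h = \<lparr> tsrc = Delta_ob I A (src A h), ttgt = Delta_ob I A (tgt A h),
     tob = (\<lambda>i\<in>Obj I. h), tmor = (\<lambda>f\<in>Mor I. id2 A h) \<rparr>"

definition Delta_cell ::
  "('i, 'f, 'x) two_cat \<Rightarrow> ('o, 'm, 'c) two_cat \<Rightarrow> 'c \<Rightarrow> ('i, 'f, 'x, 'o, 'm, 'c) modif" where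
  "Delta_cell I A b = \<lparr> msrc = Delta_mor I A (src2 A b), mtgt = Delta_mor I A (tgt2 A b),
     mob = (\<lambda>i\<in>Obj I. b) \<rparr>"


section \<open>Limits and pseudo-slices\<close>

text \<open>
  In this section the parameter \<open>T\<close> is either \<^term>\<open>Lax I A\<close> or \<^term>\<open>Ps I A\<close>.
\<close>

definition is_cone ::
  "('i, 'f, 'x, 'o, 'm, 'c) trans_two_cat \<Rightarrow> ('i, 'f, 'x) two_cat \<Rightarrow> ('o, 'm, 'c) two_cat
    \<Rightarrow> ('i, 'f, 'x, 'o, 'm, 'c) two_fun \<Rightarrow> 'o \<times> ('i, 'f, 'x, 'o, 'm, 'c) trans \<Rightarrow> bool" where
  "is_cone T I A F = (\<lambda>(x, \<mu>). x \<in> Obj A \<and> \<mu> \<in> Mor T \<and> src T \<mu> = Delta_ob I A x \<and> tgt T \<mu> = F)"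

definition is_limit ::
  "('i, 'f, 'x, 'o, 'm, 'c) trans_two_cat \<Rightarrow> ('i, 'f, 'x) two_cat \<Rightarrow> ('o, 'm, 'c) two_cat
    \<Rightarrow> ('i, 'f, 'x, 'o, 'm, 'c) two_fun \<Rightarrow> 'o \<times> ('i, 'f, 'x, 'o, 'm, 'c) trans \<Rightarrow> bool" where
  "is_limit T I A F = (\<lambda>(l, \<kappa>). is_cone T I A F (l, \<kappa>) \<and>
     (\<forall>x\<in>Obj A. iso_functor (hom_cat A x l) (hom_cat T (Delta_ob I A x) F)
        (\<lambda>h. cmp1 T \<kappa> (Delta_mor I A h))
        (\<lambda>b. hcmp T (id2 T \<kappa>) (Delta_cell I A b))))"

abbreviation lax_limit ::
  "('i, 'f, 'x) two_cat \<Rightarrow> ('o, 'm, 'c) two_cat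
    \<Rightarrow> ('i, 'f, 'x, 'o, 'm, 'c) two_fun \<Rightarrow> 'o \<times> ('i, 'f, 'x, 'o, 'm, 'c) trans \<Rightarrow> bool" where
  "lax_limit I A \<equiv> is_limit (Lax I A) I A"

abbreviation pseudo_limit ::
  "('i, 'f, 'x) two_cat \<Rightarrow> ('o, 'm, 'c) two_cat
    \<Rightarrow> ('i, 'f, 'x, 'o, 'm, 'c) two_fun \<Rightarrow> 'o \<times> ('i, 'f, 'x, 'o, 'm, 'c) trans \<Rightarrow> bool" where
  "pseudo_limit I A \<equiv> is_limit (Ps I A) I A"

text \<open>
  Morphisms and 2-morphisms of the slice carry their source and target, since these are not
  determined by the pair \<open>(h, \<phi>)\<close> respectively by the 2-morphism \<open>\<beta>\<close>.
\<close>

record ('p, 'm, 'd) slice_mor =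
  sdom :: 'p
  scod :: 'p
  sleg :: 'm
  smod :: 'd

record ('p, 'm, 'd, 'c) slice_cell =
  sdom2 :: "('p, 'm, 'd) slice_mor"
  scod2 :: "('p, 'm, 'd) slice_mor"
  sbase :: 'c

type_synonym ('i, 'f, 'x, 'o, 'm, 'c) cone = "'o \<times> ('i, 'f, 'x, 'o, 'm, 'c) trans"

type_synonym ('i, 'f, 'x, 'o, 'm, 'c) cone_mor =
  "(('i, 'f, 'x, 'o, 'm, 'c) cone, 'm, ('i, 'f, 'x, 'o, 'm, 'c) modif) slice_mor"

type_synonym ('i, 'f, 'x, 'o, 'm, 'c) cone_cell =
  "(('i, 'f, 'x, 'o, 'm, 'c) cone, 'm, ('i, 'f, 'x, 'o, 'm, 'c) modif, 'c) slice_cell"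

definition is_slice_mor ::
  "('i, 'f, 'x, 'o, 'm, 'c) trans_two_cat \<Rightarrow> ('i, 'f, 'x) two_cat \<Rightarrow> ('o, 'm, 'c) two_cat
    \<Rightarrow> ('i, 'f, 'x, 'o, 'm, 'c) two_fun \<Rightarrow> ('i, 'f, 'x, 'o, 'm, 'c) cone_mor \<Rightarrow> bool" where
  "is_slice_mor T I A F p \<longleftrightarrow>
     is_cone T I A F (sdom p) \<and> is_cone T I A F (scod p) \<and>
     sleg p \<in> Mor A \<and> src A (sleg p) = fst (sdom p) \<and> tgt A (sleg p) = fst (scod p) \<and>
     invertible_cell T (smod p) \<and>
     src2 T (smod p) = cmp1 T (snd (scod p)) (Delta_mor I A (sleg p)) \<and>
     tgt2 T (smod p) = snd (sdom p)"

definition is_slice_cell ::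
  "('i, 'f, 'x, 'o, 'm, 'c) trans_two_cat \<Rightarrow> ('i, 'f, 'x) two_cat \<Rightarrow> ('o, 'm, 'c) two_cat
    \<Rightarrow> ('i, 'f, 'x, 'o, 'm, 'c) two_fun \<Rightarrow> ('i, 'f, 'x, 'o, 'm, 'c) cone_cell \<Rightarrow> bool" where
  "is_slice_cell T I A F b \<longleftrightarrow>
     is_slice_mor T I A F (sdom2 b) \<and> is_slice_mor T I A F (scod2 b) \<and>
     sdom (scod2 b) = sdom (sdom2 b) \<and> scod (scod2 b) = scod (sdom2 b) \<and>
     sbase b \<in> Cell A \<and> src2 A (sbase b) = sleg (sdom2 b) \<and> tgt2 A (sbase b) = sleg (scod2 b) \<and>
     vcmp T (smod (scod2 b)) (hcmp T (id2 T (snd (scod (sdom2 b)))) (Delta_cell I A (sbase b)))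
       = smod (sdom2 b)"

definition slice_cmp ::
  "('i, 'f, 'x, 'o, 'm, 'c) trans_two_cat \<Rightarrow> ('i, 'f, 'x) two_cat \<Rightarrow> ('o, 'm, 'c) two_cat
    \<Rightarrow> ('i, 'f, 'x, 'o, 'm, 'c) cone_mor \<Rightarrow> ('i, 'f, 'x, 'o, 'm, 'c) cone_mor
    \<Rightarrow> ('i, 'f, 'x, 'o, 'm, 'c) cone_mor" where
  "slice_cmp T I A q p = \<lparr> sdom = sdom p, scod = scod q, sleg = cmp1 A (sleg q) (sleg p),
     smod = vcmp T (smod p) (hcmp T (smod q) (id2 T (Delta_mor I A (sleg p)))) \<rparr>"

definition pseudo_slice ::
  "('i, 'f, 'x, 'o, 'm, 'c) trans_two_cat \<Rightarrow> ('i, 'f, 'x) two_cat \<Rightarrow> ('o, 'm, 'c) two_cat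
    \<Rightarrow> ('i, 'f, 'x, 'o, 'm, 'c) two_fun
    \<Rightarrow> (('i, 'f, 'x, 'o, 'm, 'c) cone, ('i, 'f, 'x, 'o, 'm, 'c) cone_mor,
        ('i, 'f, 'x, 'o, 'm, 'c) cone_cell) two_cat" where
  "pseudo_slice T I A F = \<lparr>
     Obj = {x. is_cone T I A F x}, Mor = {p. is_slice_mor T I A F p},
     Cell = {b. is_slice_cell T I A F b},
     src = sdom, tgt = scod, src2 = sdom2, tgt2 = scod2,
     id1 = (\<lambda>x. \<lparr> sdom = x, scod = x, sleg = id1 A (fst x), smod = id2 T (snd x) \<rparr>),
     cmp1 = slice_cmp T I A,
     id2 = (\<lambda>p. \<lparr> sdom2 = p, scod2 = p, sbase = id2 A (sleg p) \<rparr>),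
     vcmp = (\<lambda>c b. \<lparr> sdom2 = sdom2 b, scod2 = scod2 c, sbase = vcmp A (sbase c) (sbase b) \<rparr>),
     hcmp = (\<lambda>c b. \<lparr> sdom2 = slice_cmp T I A (sdom2 c) (sdom2 b),
                     scod2 = slice_cmp T I A (scod2 c) (scod2 b),
                     sbase = hcmp A (sbase c) (sbase b) \<rparr>) \<rparr>"

abbreviation lax_cone_slice where
  "lax_cone_slice I A \<equiv> pseudo_slice (Lax I A) I A"

abbreviation pseudo_cone_slice where
  "pseudo_cone_slice I A \<equiv> pseudo_slice (Ps I A) I A"


section \<open>2-categories generated by data subject to relations\<close>

text \<open>
  Terms in the generators, \<open>Inv2 c\<close> being the formal inverse of a generating 2-morphism \<open>c\<close>.
  Ill-typed generators and relations between non-parallel terms are ignored.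
\<close>

datatype ('o, 'g) tm1 = Id1 'o | Gen1 'g | Cmp1 "('o, 'g) tm1" "('o, 'g) tm1"

datatype ('o, 'g, 'h) tm2 =
    Id2 "('o, 'g) tm1"
  | Gen2 'h
  | Inv2 'h
  | Vcmp "('o, 'g, 'h) tm2" "('o, 'g, 'h) tm2"
  | Hcmp "('o, 'g, 'h) tm2" "('o, 'g, 'h) tm2"

record ('o, 'g, 'h) presentation =
  gob :: "'o set"
  gmor :: "'g set"
  gsrc :: "'g \<Rightarrow> 'o"
  gtgt :: "'g \<Rightarrow> 'o"
  gcell :: "'h set"
  gsrc2 :: "'h \<Rightarrow> ('o, 'g) tm1"
  gtgt2 :: "'h \<Rightarrow> ('o, 'g) tm1"
  ginv :: "'h set"  \<comment> \<open>the generating 2-morphisms declared invertible\<close>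
  rel1 :: "(('o, 'g) tm1 \<times> ('o, 'g) tm1) set"
  rel2 :: "(('o, 'g, 'h) tm2 \<times> ('o, 'g, 'h) tm2) set"

fun dom1 :: "('o, 'g, 'h) presentation \<Rightarrow> ('o, 'g) tm1 \<Rightarrow> 'o" where
  "dom1 P (Id1 x) = x"
| "dom1 P (Gen1 g) = gsrc P g"
| "dom1 P (Cmp1 t s) = dom1 P s"

fun cod1 :: "('o, 'g, 'h) presentation \<Rightarrow> ('o, 'g) tm1 \<Rightarrow> 'o" where
  "cod1 P (Id1 x) = x"
| "cod1 P (Gen1 g) = gtgt P g"
| "cod1 P (Cmp1 t s) = cod1 P t"

fun ok1 :: "('o, 'g, 'h) presentation \<Rightarrow> ('o, 'g) tm1 \<Rightarrow> bool" where
  "ok1 P (Id1 x) \<longleftrightarrow> x \<in> gob P"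
| "ok1 P (Gen1 g) \<longleftrightarrow> g \<in> gmor P \<and> gsrc P g \<in> gob P \<and> gtgt P g \<in> gob P"
| "ok1 P (Cmp1 t s) \<longleftrightarrow> ok1 P t \<and> ok1 P s \<and> dom1 P t = cod1 P s"

inductive eq1 :: "('o, 'g, 'h) presentation \<Rightarrow> ('o, 'g) tm1 \<Rightarrow> ('o, 'g) tm1 \<Rightarrow> bool"
  for P :: "('o, 'g, 'h) presentation" where
  refl1: "ok1 P t \<Longrightarrow> eq1 P t t"
| sym1: "eq1 P s t \<Longrightarrow> eq1 P t s"
| trans1: "\<lbrakk>eq1 P s t; eq1 P t u\<rbrakk> \<Longrightarrow> eq1 P s u"
| cong1: "\<lbrakk>eq1 P t t'; eq1 P s s'; dom1 P t = cod1 P s\<rbrakk> \<Longrightarrow> eq1 P (Cmp1 t s) (Cmp1 t' s')"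
| assoc1: "ok1 P (Cmp1 (Cmp1 u t) s) \<Longrightarrow> eq1 P (Cmp1 (Cmp1 u t) s) (Cmp1 u (Cmp1 t s))"
| left_id1: "ok1 P t \<Longrightarrow> eq1 P (Cmp1 (Id1 (cod1 P t)) t) t"
| right_id1: "ok1 P t \<Longrightarrow> eq1 P (Cmp1 t (Id1 (dom1 P t))) t"
| rel1: "\<lbrakk>(s, t) \<in> rel1 P; ok1 P s; ok1 P t; dom1 P s = dom1 P t; cod1 P s = cod1 P t\<rbrakk>
    \<Longrightarrow> eq1 P s t"

fun dom2 :: "('o, 'g, 'h) presentation \<Rightarrow> ('o, 'g, 'h) tm2 \<Rightarrow> ('o, 'g) tm1" where
  "dom2 P (Id2 t) = t"
| "dom2 P (Gen2 c) = gsrc2 P c"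
| "dom2 P (Inv2 c) = gtgt2 P c"
| "dom2 P (Vcmp b a) = dom2 P a"
| "dom2 P (Hcmp b a) = Cmp1 (dom2 P b) (dom2 P a)"

fun cod2 :: "('o, 'g, 'h) presentation \<Rightarrow> ('o, 'g, 'h) tm2 \<Rightarrow> ('o, 'g) tm1" where
  "cod2 P (Id2 t) = t"
| "cod2 P (Gen2 c) = gtgt2 P c"
| "cod2 P (Inv2 c) = gsrc2 P c"
| "cod2 P (Vcmp b a) = cod2 P b"
| "cod2 P (Hcmp b a) = Cmp1 (cod2 P b) (cod2 P a)"

text \<open>Vertical composability only requires the intermediate 1-terms to be equal modulo \<^const>\<open>eq1\<close>.\<close>

fun ok2 :: "('o, 'g, 'h) presentation \<Rightarrow> ('o, 'g, 'h) tm2 \<Rightarrow> bool" where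
  "ok2 P (Id2 t) \<longleftrightarrow> ok1 P t"
| "ok2 P (Gen2 c) \<longleftrightarrow> c \<in> gcell P \<and> ok1 P (gsrc2 P c) \<and> ok1 P (gtgt2 P c) \<and>
     dom1 P (gsrc2 P c) = dom1 P (gtgt2 P c) \<and> cod1 P (gsrc2 P c) = cod1 P (gtgt2 P c)"
| "ok2 P (Inv2 c) \<longleftrightarrow> c \<in> ginv P \<and> c \<in> gcell P \<and> ok1 P (gsrc2 P c) \<and> ok1 P (gtgt2 P c) \<and>
     dom1 P (gsrc2 P c) = dom1 P (gtgt2 P c) \<and> cod1 P (gsrc2 P c) = cod1 P (gtgt2 P c)"
| "ok2 P (Vcmp b a) \<longleftrightarrow> ok2 P b \<and> ok2 P a \<and> eq1 P (dom2 P b) (cod2 P a)"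
| "ok2 P (Hcmp b a) \<longleftrightarrow> ok2 P b \<and> ok2 P a \<and> dom1 P (dom2 P b) = cod1 P (dom2 P a)"

inductive eq2 :: "('o, 'g, 'h) presentation \<Rightarrow> ('o, 'g, 'h) tm2 \<Rightarrow> ('o, 'g, 'h) tm2 \<Rightarrow> bool"
  for P :: "('o, 'g, 'h) presentation" where
  refl2: "ok2 P a \<Longrightarrow> eq2 P a a"
| sym2: "eq2 P a b \<Longrightarrow> eq2 P b a"
| trans2: "\<lbrakk>eq2 P a b; eq2 P b c\<rbrakk> \<Longrightarrow> eq2 P a c"
| id_cong2: "eq1 P s t \<Longrightarrow> eq2 P (Id2 s) (Id2 t)"
| vcong2: "\<lbrakk>eq2 P b b'; eq2 P a a'; eq1 P (dom2 P b) (cod2 P a)\<rbrakk>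
    \<Longrightarrow> eq2 P (Vcmp b a) (Vcmp b' a')"
| hcong2: "\<lbrakk>eq2 P b b'; eq2 P a a'; dom1 P (dom2 P b) = cod1 P (dom2 P a)\<rbrakk>
    \<Longrightarrow> eq2 P (Hcmp b a) (Hcmp b' a')"
| vassoc2: "ok2 P (Vcmp (Vcmp c b) a) \<Longrightarrow> eq2 P (Vcmp (Vcmp c b) a) (Vcmp c (Vcmp b a))"
| vleft_id2: "ok2 P a \<Longrightarrow> eq2 P (Vcmp (Id2 (cod2 P a)) a) a"
| vright_id2: "ok2 P a \<Longrightarrow> eq2 P (Vcmp a (Id2 (dom2 P a))) a"
| hassoc2: "ok2 P (Hcmp (Hcmp c b) a) \<Longrightarrow> eq2 P (Hcmp (Hcmp c b) a) (Hcmp c (Hcmp b a))"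
| hleft_id2: "ok2 P a \<Longrightarrow> eq2 P (Hcmp (Id2 (Id1 (cod1 P (dom2 P a)))) a) a"
| hright_id2: "ok2 P a \<Longrightarrow> eq2 P (Hcmp a (Id2 (Id1 (dom1 P (dom2 P a))))) a"
| hcmp_id2: "ok1 P (Cmp1 t s) \<Longrightarrow> eq2 P (Hcmp (Id2 t) (Id2 s)) (Id2 (Cmp1 t s))"
| interchange2: "\<lbrakk>ok2 P (Vcmp b' b); ok2 P (Vcmp a' a); ok2 P (Hcmp b a)\<rbrakk>
    \<Longrightarrow> eq2 P (Hcmp (Vcmp b' b) (Vcmp a' a)) (Vcmp (Hcmp b' a') (Hcmp b a))"
| inv_left2: "ok2 P (Inv2 c) \<Longrightarrow> eq2 P (Vcmp (Inv2 c) (Gen2 c)) (Id2 (gsrc2 P c))"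
| inv_right2: "ok2 P (Inv2 c) \<Longrightarrow> eq2 P (Vcmp (Gen2 c) (Inv2 c)) (Id2 (gtgt2 P c))"
| rel2: "\<lbrakk>(a, b) \<in> rel2 P; ok2 P a; ok2 P b;
      eq1 P (dom2 P a) (dom2 P b); eq1 P (cod2 P a) (cod2 P b)\<rbrakk> \<Longrightarrow> eq2 P a b"

definition cls1 :: "('o, 'g, 'h) presentation \<Rightarrow> ('o, 'g) tm1 \<Rightarrow> ('o, 'g) tm1 set" where
  "cls1 P t = {s. eq1 P t s}"

definition cls2 :: "('o, 'g, 'h) presentation \<Rightarrow> ('o, 'g, 'h) tm2 \<Rightarrow> ('o, 'g, 'h) tm2 set" where
  "cls2 P a = {b. eq2 P a b}"

definition rep :: "'t set \<Rightarrow> 't" where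
  "rep S = (SOME t. t \<in> S)"

text \<open>
  Morphisms and 2-morphisms are equivalence classes of well-typed terms; since \<^const>\<open>eq1\<close> and
  \<^const>\<open>eq2\<close> are congruences, the operations do not depend on the representative \<^const>\<open>rep\<close>.
\<close>

definition generated ::
  "('o, 'g, 'h) presentation \<Rightarrow> ('o, ('o, 'g) tm1 set, ('o, 'g, 'h) tm2 set) two_cat" where
  "generated P = \<lparr>
     Obj = gob P,
     Mor = {cls1 P t | t. ok1 P t},
     Cell = {cls2 P a | a. ok2 P a},
     src = (\<lambda>S. dom1 P (rep S)),
     tgt = (\<lambda>S. cod1 P (rep S)),
     src2 = (\<lambda>S. cls1 P (dom2 P (rep S))),
     tgt2 = (\<lambda>S. cls1 P (cod2 P (rep S))),
     id1 = (\<lambda>x. cls1 P (Id1 x)),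
     cmp1 = (\<lambda>T S. cls1 P (Cmp1 (rep T) (rep S))),
     id2 = (\<lambda>S. cls2 P (Id2 (rep S))),
     vcmp = (\<lambda>T S. cls2 P (Vcmp (rep T) (rep S))),
     hcmp = (\<lambda>T S. cls2 P (Hcmp (rep T) (rep S))) \<rparr>"


section \<open>The 2-category, the diagram and the cone\<close>

datatype gen_ob = ObX | ObA | ObB
datatype gen_mor = Alpha0 | Alpha1 | MorF
datatype gen_cell = Alpha

definition exP :: "(gen_ob, gen_mor, gen_cell) presentation" where
  "exP = \<lparr> gob = {ObX, ObA, ObB},
     gmor = {Alpha0, Alpha1, MorF},
     gsrc = (\<lambda>g. case g of Alpha0 \<Rightarrow> ObX | Alpha1 \<Rightarrow> ObX | MorF \<Rightarrow> ObA),
     gtgt = (\<lambda>g. case g of Alpha0 \<Rightarrow> ObA | Alpha1 \<Rightarrow> ObA | MorF \<Rightarrow> ObB),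
     gcell = {Alpha},
     gsrc2 = (\<lambda>_. Gen1 Alpha0),
     gtgt2 = (\<lambda>_. Gen1 Alpha1),
     ginv = {Alpha},
     rel1 = {(Cmp1 (Gen1 MorF) (Gen1 Alpha0), Cmp1 (Gen1 MorF) (Gen1 Alpha1))},
     rel2 = {(Hcmp (Id2 (Gen1 MorF)) (Gen2 Alpha), Id2 (Cmp1 (Gen1 MorF) (Gen1 Alpha0)))} \<rparr>"

definition exA ::
  "(gen_ob, (gen_ob, gen_mor) tm1 set, (gen_ob, gen_mor, gen_cell) tm2 set) two_cat" where
  "exA = generated exP"

definition exf :: "(gen_ob, gen_mor) tm1 set" where
  "exf = cls1 exP (Gen1 MorF)"

text \<open>The 2-functor from \<^const>\<open>two\<close> given by a morphism \<open>f\<close>.\<close>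

definition mor_functor ::
  "('o, 'm, 'c) two_cat \<Rightarrow> 'm \<Rightarrow> (nat, nat \<times> nat, nat \<times> nat, 'o, 'm, 'c) two_fun" where
  "mor_functor A f =
    (let m = (\<lambda>p. if p = (0, 1) then f else if p = (0, 0) then id1 A (src A f) else id1 A (tgt A f))
     in \<lparr> fob = (\<lambda>i\<in>Obj two. if i = 0 then src A f else tgt A f),
          fmor = (\<lambda>p\<in>Mor two. m p), fcell = (\<lambda>p\<in>Cell two. id2 A (m p)) \<rparr>)"

text \<open>
  The cone over \<^term>\<open>mor_functor A f\<close> with vertex \<open>src A f\<close>, components \<open>id1 A (src A f)\<close> and \<open>f\<close>,
  and 2-morphism component \<open>id2 A f\<close> at \<open>0 \<rightarrow> 1\<close>; its 2-morphism components at the identities of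
  \<^const>\<open>two\<close> are forced to be identities.
\<close>

definition id_cone ::
  "('o, 'm, 'c) two_cat \<Rightarrow> 'm \<Rightarrow> (nat, nat \<times> nat, nat \<times> nat, 'o, 'm, 'c) trans" where
  "id_cone A f = \<lparr> tsrc = Delta_ob two A (src A f), ttgt = mor_functor A f,
     tob = (\<lambda>i\<in>Obj two. if i = 0 then id1 A (src A f) else f),
     tmor = (\<lambda>p\<in>Mor two. if p = (0, 0) then id2 A (id1 A (src A f)) else id2 A f) \<rparr>"

end

(*
  Every 2-morphism of the generated 2-category with codomain B is an identity: whiskering with f
  kills alpha, hence also its inverse, and whiskering is compatible with both compositions. So a
  lax cone over f is determined by its component at A and is automatically pseudo-natural, and
  a modification is determined by its component at A; this is the limit property of (A, id_f). On the
  other hand, the cone with vertex X and component alpha_1 at A has two different morphisms into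
  (A, id_f) in the pseudo-slice, with legs alpha_1 and alpha_0, so that (A, id_f) is not 2-terminal.
*)

theory Submission
  imports Defs
begin

section \<open>Generated 2-categories\<close>

lemma ok1_gob: "ok1 P t \<Longrightarrow> dom1 P t \<in> gob P \<and> cod1 P t \<in> gob P"
  by (induction t) auto

text \<open>\<open>cong1\<close> demands composability of its left-hand side only; the right-hand
  composite is well typed because equal factors have equal endpoints by induction.\<close>

lemma eq1_ok:
  "eq1 P s t \<Longrightarrow> ok1 P s \<and> ok1 P t \<and> dom1 P s = dom1 P t \<and> cod1 P s = cod1 P t"
  by (induction rule: eq1.induct) (auto simp: ok1_gob)

lemma ok2_boundary:
  "ok2 P a \<Longrightarrow> ok1 P (dom2 P a) \<and> ok1 P (cod2 P a) \<and>
     dom1 P (cod2 P a) = dom1 P (dom2 P a) \<and> cod1 P (cod2 P a) = cod1 P (dom2 P a)"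
  by (induction a) (auto dest: eq1_ok)

text \<open>Boundaries agree only up to \<open>eq1\<close>: the associativity and unit clauses for
  \<open>Hcmp\<close> change the boundary 1-terms, and \<open>Vcmp\<close> itself composes across
  \<open>eq1\<close>.\<close>

lemma eq2_ok:
  "eq2 P a b \<Longrightarrow> ok2 P a \<and> ok2 P b \<and> eq1 P (dom2 P a) (dom2 P b) \<and> eq1 P (cod2 P a) (cod2 P b)"
proof (induction rule: eq2.induct)
  case (refl2 a)
  then show ?case using ok2_boundary[of P a] by (auto intro: refl1)
next
  case (sym2 a b)
  then show ?case by (auto intro: sym1)
next
  case (trans2 a b c)
  then show ?case by (auto intro: trans1)
next
  case (id_cong2 s t)
  then show ?case by (auto dest: eq1_ok)
next
  case (vcong2 b b' a a')
  then show ?case by (auto intro: sym1 trans1)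
next
  case (hcong2 b b' a a')
  then have "dom1 P (cod2 P b) = cod1 P (cod2 P a)"
    using ok2_boundary[of P b] ok2_boundary[of P a] by simp
  with hcong2 show ?case
    using eq1_ok[of P "dom2 P b"] eq1_ok[of P "dom2 P a"] by (auto intro: cong1)
next
  case (vassoc2 c b a)
  then show ?case
    using ok2_boundary[of P a] ok2_boundary[of P c] by (auto intro: refl1)
next
  case (vleft_id2 a)
  then show ?case using ok2_boundary[of P a] by (auto intro: refl1)
next
  case (vright_id2 a)
  then show ?case using ok2_boundary[of P a] by (auto intro: refl1)
next
  case (hassoc2 c b a)
  then show ?case
    using ok2_boundary[of P a] ok2_boundary[of P b] ok2_boundary[of P c] by (auto intro!: assoc1)
next
  case (hleft_id2 a)
  then show ?case
    using ok2_boundary[of P a] ok1_gob[of P "dom2 P a"]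
      left_id1[of P "dom2 P a"] left_id1[of P "cod2 P a"] by auto
next
  case (hright_id2 a)
  then show ?case
    using ok2_boundary[of P a] ok1_gob[of P "dom2 P a"]
      right_id1[of P "dom2 P a"] right_id1[of P "cod2 P a"] by auto
next
  case (hcmp_id2 t s)
  then show ?case by (auto intro!: refl1)
next
  case (interchange2 b' b a' a)
  then show ?case
    using ok2_boundary[of P a] ok2_boundary[of P a'] ok2_boundary[of P b] ok2_boundary[of P b']
      eq1_ok[of P "dom2 P b'" "cod2 P b"] eq1_ok[of P "dom2 P a'" "cod2 P a"]
    by (auto intro!: refl1 cong1)
next
  case (inv_left2 c)
  then show ?case by (auto intro!: refl1)
next
  case (inv_right2 c)
  then show ?case by (auto intro!: refl1)
next
  case (rel2 a b)
  then show ?case by auto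
qed

lemma cls1_eqI: "eq1 P s t \<Longrightarrow> cls1 P s = cls1 P t"
  unfolding cls1_def by (blast intro: sym1 trans1)

lemma cls2_eqI: "eq2 P a b \<Longrightarrow> cls2 P a = cls2 P b"
  unfolding cls2_def by (blast intro: sym2 trans2)

text \<open>Well-typedness puts \<open>t\<close> into its own class; two ill-typed terms would share
  the empty class.\<close>

lemma cls1_eq_iff: "ok1 P t \<Longrightarrow> cls1 P s = cls1 P t \<longleftrightarrow> eq1 P s t"
  using refl1[of P t] cls1_eqI[of P s t] by (auto simp: cls1_def)

lemma eq1_rep: "ok1 P t \<Longrightarrow> eq1 P (rep (cls1 P t)) t"
  unfolding rep_def cls1_def by (rule sym1, rule someI2) (auto intro: refl1)

lemma eq2_rep: "ok2 P a \<Longrightarrow> eq2 P (rep (cls2 P a)) a"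
  unfolding rep_def cls2_def by (rule sym2, rule someI2) (auto intro: refl2)

section \<open>Operations of the generated 2-category on classes\<close>

lemma Obj_generated [simp]: "Obj (generated P) = gob P"
  by (simp add: generated_def)

lemma Mor_generated [simp]: "cls1 P t \<in> Mor (generated P) \<longleftrightarrow> ok1 P t"
  by (auto simp: generated_def cls1_eq_iff dest: eq1_ok)

lemma Cell_generated [simp]: "ok2 P a \<Longrightarrow> cls2 P a \<in> Cell (generated P)"
  by (auto simp: generated_def)

lemma Mor_generatedE:
  assumes "f \<in> Mor (generated P)"
  obtains t where "f = cls1 P t" "ok1 P t"
  using assms by (auto simp: generated_def)

lemma Cell_generatedE:
  assumes "f \<in> Cell (generated P)"
  obtains a where "f = cls2 P a" "ok2 P a"
  using assms by (auto simp: generated_def)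

lemma id1_generated [simp]: "id1 (generated P) x = cls1 P (Id1 x)"
  by (simp add: generated_def)

text \<open>\<open>rep\<close> may choose a term other than \<open>t\<close>, but endpoints and
  \<open>Id2\<close> respect \<open>eq1\<close>.\<close>

lemma generated_mor_simps [simp]:
  assumes "ok1 P t"
  shows "src (generated P) (cls1 P t) = dom1 P t"
    and "tgt (generated P) (cls1 P t) = cod1 P t"
    and "id2 (generated P) (cls1 P t) = cls2 P (Id2 t)"
  using eq1_ok[OF eq1_rep[OF assms]] cls2_eqI[OF id_cong2[OF eq1_rep[OF assms]]]
  by (auto simp: generated_def)

lemma cmp1_generated [simp]:
  "ok1 P (Cmp1 t s) \<Longrightarrow> cmp1 (generated P) (cls1 P t) (cls1 P s) = cls1 P (Cmp1 t s)"
  using eq1_rep[of P t] eq1_rep[of P s] eq1_ok[of P "rep (cls1 P t)" t] eq1_ok[of P "rep (cls1 P s)" s]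
  by (auto simp: generated_def intro!: cls1_eqI cong1)

lemma generated_cell_simps [simp]:
  assumes "ok2 P a"
  shows "src2 (generated P) (cls2 P a) = cls1 P (dom2 P a)"
    and "tgt2 (generated P) (cls2 P a) = cls1 P (cod2 P a)"
  using eq2_ok[OF eq2_rep[OF assms]] by (auto simp: generated_def intro!: cls1_eqI)

lemma vcmp_generated [simp]:
  "ok2 P (Vcmp b a) \<Longrightarrow> vcmp (generated P) (cls2 P b) (cls2 P a) = cls2 P (Vcmp b a)"
  using eq2_rep[of P b] eq2_rep[of P a] eq2_ok[of P "rep (cls2 P b)" b] eq2_ok[of P "rep (cls2 P a)" a]
  by (auto simp: generated_def intro!: cls2_eqI vcong2 intro: sym1 trans1)

lemma hcmp_generated [simp]:
  "ok2 P (Hcmp b a) \<Longrightarrow> hcmp (generated P) (cls2 P b) (cls2 P a) = cls2 P (Hcmp b a)"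
  using eq2_rep[of P b] eq2_rep[of P a] eq2_ok[of P "rep (cls2 P b)" b] eq2_ok[of P "rep (cls2 P a)" a]
    eq1_ok[of P "dom2 P (rep (cls2 P b))" "dom2 P b"] eq1_ok[of P "dom2 P (rep (cls2 P a))" "dom2 P a"]
  by (auto simp: generated_def intro!: cls2_eqI hcong2)

lemma ok2_dom_cod [simp]:
  assumes "ok2 P a"
  shows "ok1 P (dom2 P a)" "ok1 P (cod2 P a)"
    "dom1 P (cod2 P a) = dom1 P (dom2 P a)" "cod1 P (cod2 P a) = cod1 P (dom2 P a)"
  using ok2_boundary[OF assms] by auto

lemma cls2_eq_iff: "ok2 P b \<Longrightarrow> cls2 P a = cls2 P b \<longleftrightarrow> eq2 P a b"
  using refl2[of P b] cls2_eqI[of P a b] by (auto simp: cls2_def)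

text \<open>Once representatives are chosen, each axiom is a typing fact or a clause of
  \<open>eq1\<close> or \<open>eq2\<close>. Interchange, goal 32, is treated apart because a
  composability condition has to be derived first.\<close>

lemma two_category_generated: "two_category (generated P)"
proof (unfold_locales, goal_cases)
  case (32 b' b a' a)
  obtain \<beta>' \<beta> \<alpha>' \<alpha>
    where cls: "b' = cls2 P \<beta>'" "b = cls2 P \<beta>" "a' = cls2 P \<alpha>'" "a = cls2 P \<alpha>"
      and ok: "ok2 P \<beta>'" "ok2 P \<beta>" "ok2 P \<alpha>'" "ok2 P \<alpha>"
    using 32(1-4) by (elim Cell_generatedE) blast
  have \<beta>: "eq1 P (dom2 P \<beta>') (cod2 P \<beta>)" and \<alpha>: "eq1 P (dom2 P \<alpha>') (cod2 P \<alpha>)"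
    and hcomp: "dom1 P (dom2 P \<beta>) = cod1 P (dom2 P \<alpha>)"
    using 32(5-7) ok by (simp_all add: cls cls1_eq_iff)
  \<comment> \<open>The axiom assumes horizontal composability of the first pair only; it passes to
    the second because 2-terms have parallel boundaries.\<close>
  then have hcomp': "dom1 P (dom2 P \<beta>') = cod1 P (dom2 P \<alpha>')"
    using ok eq1_ok[OF \<beta>] eq1_ok[OF \<alpha>] by simp
  have "eq1 P (Cmp1 (dom2 P \<beta>') (dom2 P \<alpha>')) (Cmp1 (cod2 P \<beta>) (cod2 P \<alpha>))"
    using \<beta> \<alpha> hcomp' by (rule cong1)
  then show ?case
    using ok \<beta> \<alpha> hcomp hcomp' by (simp add: cls cls2_eq_iff interchange2)
qed ((elim Mor_generatedE Cell_generatedE)?;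
    simp add: ok1_gob cls1_eq_iff cls2_eq_iff refl1 left_id1 right_id1 assoc1
      vleft_id2 vright_id2 vassoc2 hleft_id2 hright_id2 hassoc2 hcmp_id2)+

text \<open>Term induction moved to the quotient, so that later inductions can use the laws of a
  2-category. Formal inverses of generators are a case of their own.\<close>

lemma Cell_generated_induct:
  assumes "c \<in> Cell (generated P)"
    and "\<And>f. f \<in> Mor (generated P) \<Longrightarrow> Q (id2 (generated P) f)"
    and "\<And>h. ok2 P (Gen2 h) \<Longrightarrow> Q (cls2 P (Gen2 h))"
    and "\<And>h. ok2 P (Inv2 h) \<Longrightarrow> Q (cls2 P (Inv2 h))"
    and "\<And>b a. \<lbrakk>b \<in> Cell (generated P); a \<in> Cell (generated P);
        src2 (generated P) b = tgt2 (generated P) a; Q b; Q a\<rbrakk> \<Longrightarrow> Q (vcmp (generated P) b a)"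
    and "\<And>b a. \<lbrakk>b \<in> Cell (generated P); a \<in> Cell (generated P);
        src (generated P) (src2 (generated P) b) = tgt (generated P) (src2 (generated P) a); Q b; Q a\<rbrakk>
      \<Longrightarrow> Q (hcmp (generated P) b a)"
  shows "Q c"
proof -
  have "ok2 P a \<Longrightarrow> Q (cls2 P a)" for a
  proof (induction a)
    case (Id2 t)
    then show ?case using assms(2)[of "cls1 P t"] by simp
  next
    case (Vcmp b a)
    then show ?case using assms(5)[of "cls2 P b" "cls2 P a"] by (simp add: cls1_eq_iff)
  next
    case (Hcmp b a)
    then show ?case using assms(6)[of "cls2 P b" "cls2 P a"] by simp
  qed (use assms(3,4) in blast)+
  with assms(1) show ?thesis by (auto elim: Cell_generatedE)
qed

section \<open>The category of modifications between two 2-functors\<close>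

lemma lax_simps [simp]:
  "Obj (Lax I A) = {F. two_functor I A F}" "Mor (Lax I A) = {\<mu>. lax_natural I A \<mu>}"
  "Cell (Lax I A) = {\<phi>. modification I A \<phi>}"
  "src (Lax I A) = tsrc" "tgt (Lax I A) = ttgt" "src2 (Lax I A) = msrc" "tgt2 (Lax I A) = mtgt"
  "id1 (Lax I A) = trans_id I A" "cmp1 (Lax I A) = trans_cmp I A"
  "id2 (Lax I A) = modif_id I A" "vcmp (Lax I A) = modif_vcmp I A" "hcmp (Lax I A) = modif_hcmp I A"
  by (simp_all add: Lax_def)

lemma ps_simps [simp]:
  "Obj (Ps I A) = {F. two_functor I A F}" "Mor (Ps I A) = {\<mu>. pseudo_natural I A \<mu>}"
  "Cell (Ps I A) =
     {\<phi>. modification I A \<phi> \<and> pseudo_natural I A (msrc \<phi>) \<and> pseudo_natural I A (mtgt \<phi>)}"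
  "src (Ps I A) = tsrc" "tgt (Ps I A) = ttgt" "src2 (Ps I A) = msrc" "tgt2 (Ps I A) = mtgt"
  "id1 (Ps I A) = trans_id I A" "cmp1 (Ps I A) = trans_cmp I A"
  "id2 (Ps I A) = modif_id I A" "vcmp (Ps I A) = modif_vcmp I A" "hcmp (Ps I A) = modif_hcmp I A"
  by (simp_all add: Ps_def)

context two_category
begin

lemmas two_cat_simps [simp] =
  src_ob tgt_ob id1_mor src_id1 tgt_id1 cmp1_mor src_cmp1 tgt_cmp1 cmp1_id_left cmp1_id_right
  src2_mor tgt2_mor src_tgt2 tgt_tgt2 id2_cell src2_id2 tgt2_id2 vcmp_cell src2_vcmp tgt2_vcmp
  vcmp_id_left vcmp_id_right hcmp_cell src2_hcmp tgt2_hcmp hcmp_id_left hcmp_id_right hcmp_id2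

text \<open>In this and the following unit laws the endpoint is a separate variable: the simplifier
  tends to replace \<open>tgt A h\<close> by its value, after which the original laws no longer
  match.\<close>

lemma cmp1_id_left': "h \<in> Mor A \<Longrightarrow> tgt A h = y \<Longrightarrow> cmp1 A (id1 A y) h = h"
  using cmp1_id_left by blast

lemma cmp1_id_right': "h \<in> Mor A \<Longrightarrow> src A h = x \<Longrightarrow> cmp1 A h (id1 A x) = h"
  using cmp1_id_right by blast

lemma hcmp_id_left': "b \<in> Cell A \<Longrightarrow> tgt A (src2 A b) = y \<Longrightarrow> hcmp A (id2 A (id1 A y)) b = b"
  using hcmp_id_left by blast

lemma hcmp_id_right': "b \<in> Cell A \<Longrightarrow> src A (src2 A b) = x \<Longrightarrow> hcmp A b (id2 A (id1 A x)) = b"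
  using hcmp_id_right by blast

lemma vcmp_id_left': "b \<in> Cell A \<Longrightarrow> tgt2 A b = h \<Longrightarrow> vcmp A (id2 A h) b = b"
  using vcmp_id_left by blast

lemma vcmp_id_right': "b \<in> Cell A \<Longrightarrow> src2 A b = h \<Longrightarrow> vcmp A b (id2 A h) = b"
  using vcmp_id_right by blast

lemmas unit_simps =
  cmp1_id_left' cmp1_id_right' hcmp_id_left' hcmp_id_right' vcmp_id_left' vcmp_id_right'

lemma invertible_id2: "h \<in> Mor A \<Longrightarrow> invertible_cell A (id2 A h)"
  unfolding invertible_cell_def
  by (intro conjI bexI[of _ "id2 A h"]) (simp_all add: unit_simps)

text \<open>Interchange, with the identity of \<open>f\<close> written as its vertical composite
  with itself.\<close>

lemma whisker_left_vcmp:
  assumes "f \<in> Mor A" "b \<in> Cell A" "a \<in> Cell A" "src2 A b = tgt2 A a"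
    "src A f = tgt A (src2 A a)"
  shows "hcmp A (id2 A f) (vcmp A b a) = vcmp A (hcmp A (id2 A f) b) (hcmp A (id2 A f) a)"
  using interchange[of "id2 A f" "id2 A f" b a] vcmp_id_left[of "id2 A f"] assms by simp

lemma whisker_right_vcmp:
  assumes "f \<in> Mor A" "b \<in> Cell A" "a \<in> Cell A" "src2 A b = tgt2 A a"
    "tgt A f = src A (src2 A a)"
  shows "hcmp A (vcmp A b a) (id2 A f) = vcmp A (hcmp A b (id2 A f)) (hcmp A a (id2 A f))"
  using interchange[of b a "id2 A f" "id2 A f"] vcmp_id_left[of "id2 A f"] assms by simp

lemma category_hom_cat:
  "category (hom_cat A x y)"
  by unfold_locales (auto simp: hom_cat_def vcmp_assoc)

end

section \<open>Vertical composition of modifications\<close>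

lemma modification_two_category: "modification I A \<phi> \<Longrightarrow> two_category A"
  by (meson two_functor.axioms lax_natural.axioms modification.axioms)

lemma modification_id:
  assumes "lax_natural I A \<mu>"
  shows "modification I A (modif_id I A \<mu>)"
proof -
  interpret lax_natural I A \<mu> by fact
  show ?thesis
    by (intro modification.intro modification_axioms.intro)
      (auto simp: modif_id_def assms tob_mor src_tob tgt_tob tmor_cell F.fmor_mor G.fmor_mor
        F.src_fmor F.tgt_fmor G.src_fmor G.tgt_fmor src2_tmor[symmetric] tgt2_tmor[symmetric])
qed

text \<open>The naturality squares of \<open>\<phi>\<close> and \<open>\<psi>\<close> are pasted
  along \<open>tmor (mtgt \<phi>) f\<close>.\<close>

lemma modification_vcmp:
  assumes "modification I A \<psi>" "modification I A \<phi>" "msrc \<psi> = mtgt \<phi>"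
  shows "modification I A (modif_vcmp I A \<psi> \<phi>)"
proof -
  interpret A: two_category A
    using assms(2) by (rule modification_two_category)
  interpret \<psi>: modification I A \<psi> by fact
  interpret \<phi>: modification I A \<phi> by fact
  let ?F = "tsrc (msrc \<phi>)" and ?G = "ttgt (msrc \<phi>)"
  let ?\<mu> = "msrc \<phi>" and ?\<nu> = "mtgt \<phi>" and ?\<kappa> = "mtgt \<psi>"
  have nat: "vcmp A (tmor ?\<kappa> f)
          (hcmp A (id2 A (fmor ?G f)) (vcmp A (mob \<psi> (src I f)) (mob \<phi> (src I f)))) =
        vcmp A (hcmp A (vcmp A (mob \<psi> (tgt I f)) (mob \<phi> (tgt I f))) (id2 A (fmor ?F f))) (tmor ?\<mu> f)"
    if f: "f \<in> Mor I" for f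
  proof -
    note [simp] = f \<psi>.mob_cell \<phi>.mob_cell \<psi>.src2_mob \<psi>.tgt2_mob \<phi>.src2_mob \<phi>.tgt2_mob assms(3)
      \<phi>.S.tob_mor \<phi>.S.src_tob \<phi>.S.tgt_tob \<phi>.T.tob_mor \<phi>.T.src_tob \<phi>.T.tgt_tob
      \<psi>.T.tob_mor \<psi>.T.src_tob \<psi>.T.tgt_tob \<psi>.tsrc_eq \<psi>.ttgt_eq \<phi>.tsrc_eq \<phi>.ttgt_eq
      \<phi>.S.F.fmor_mor \<phi>.S.F.src_fmor \<phi>.S.F.tgt_fmor \<phi>.S.G.fmor_mor \<phi>.S.G.src_fmor \<phi>.S.G.tgt_fmor
      \<phi>.S.tmor_cell \<phi>.S.src2_tmor \<phi>.S.tgt2_tmor \<phi>.T.tmor_cell \<phi>.T.src2_tmor \<phi>.T.tgt2_tmor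
      \<psi>.T.tmor_cell \<psi>.T.src2_tmor \<psi>.T.tgt2_tmor
    let ?L = "\<lambda>\<chi>. hcmp A (id2 A (fmor ?G f)) (mob \<chi> (src I f))"
    let ?R = "\<lambda>\<chi>. hcmp A (mob \<chi> (tgt I f)) (id2 A (fmor ?F f))"
    have "vcmp A (tmor ?\<kappa> f) (vcmp A (?L \<psi>) (?L \<phi>)) = vcmp A (vcmp A (tmor ?\<kappa> f) (?L \<psi>)) (?L \<phi>)"
      by (simp add: A.vcmp_assoc)
    also have "\<dots> = vcmp A (vcmp A (?R \<psi>) (tmor ?\<nu> f)) (?L \<phi>)"
      using \<psi>.mob_nat[OF f] by simp
    also have "\<dots> = vcmp A (?R \<psi>) (vcmp A (tmor ?\<nu> f) (?L \<phi>))"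
      by (simp add: A.vcmp_assoc)
    also have "\<dots> = vcmp A (?R \<psi>) (vcmp A (?R \<phi>) (tmor ?\<mu> f))"
      using \<phi>.mob_nat[OF f] by simp
    also have "\<dots> = vcmp A (vcmp A (?R \<psi>) (?R \<phi>)) (tmor ?\<mu> f)"
      by (simp add: A.vcmp_assoc)
    finally show ?thesis
      by (simp add: A.whisker_left_vcmp A.whisker_right_vcmp)
  qed
  show ?thesis
    by (intro modification.intro modification_axioms.intro)
      (simp_all add: modif_vcmp_def \<psi>.T.lax_natural_axioms \<phi>.S.lax_natural_axioms assms(3) nat
        \<psi>.tsrc_eq \<psi>.ttgt_eq \<phi>.tsrc_eq \<phi>.ttgt_eq
        \<psi>.mob_cell \<phi>.mob_cell \<psi>.src2_mob \<psi>.tgt2_mob \<phi>.src2_mob \<phi>.tgt2_mob)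
qed

lemma modif_vcmp_id:
  assumes "modification I A \<phi>"
  shows "modif_vcmp I A (modif_id I A (mtgt \<phi>)) \<phi> = \<phi>"
    and "modif_vcmp I A \<phi> (modif_id I A (msrc \<phi>)) = \<phi>"
proof -
  interpret A: two_category A
    using assms by (rule modification_two_category)
  interpret modification I A \<phi> by fact
  have "vcmp A (id2 A (tob (mtgt \<phi>) i)) (mob \<phi> i) = mob \<phi> i"
    "vcmp A (mob \<phi> i) (id2 A (tob (msrc \<phi>) i)) = mob \<phi> i" if "i \<in> Obj I" for i
    using that mob_cell A.vcmp_id_left[of "mob \<phi> i"] A.vcmp_id_right[of "mob \<phi> i"]
    by (simp_all add: src2_mob tgt2_mob)
  \<comment> \<open>Outside \<open>Obj I\<close> both sides are \<open>undefined\<close>, by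
    extensionality.\<close>
  then have mob: "(\<lambda>i\<in>Obj I. vcmp A ((\<lambda>i\<in>Obj I. id2 A (tob (mtgt \<phi>) i)) i) (mob \<phi> i)) = mob \<phi>"
    "(\<lambda>i\<in>Obj I. vcmp A (mob \<phi> i) ((\<lambda>i\<in>Obj I. id2 A (tob (msrc \<phi>) i)) i)) = mob \<phi>"
    by (auto simp: fun_eq_iff extensional_arb[OF mob_ext])
  show "modif_vcmp I A (modif_id I A (mtgt \<phi>)) \<phi> = \<phi>"
    and "modif_vcmp I A \<phi> (modif_id I A (msrc \<phi>)) = \<phi>"
    unfolding modif_vcmp_def modif_id_def modif.select_convs mob by simp_all
qed

lemma modif_vcmp_assoc:
  assumes "modification I A \<chi>" "modification I A \<psi>" "modification I A \<phi>"
    "msrc \<chi> = mtgt \<psi>" "msrc \<psi> = mtgt \<phi>"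
  shows "modif_vcmp I A (modif_vcmp I A \<chi> \<psi>) \<phi> = modif_vcmp I A \<chi> (modif_vcmp I A \<psi> \<phi>)"
proof -
  interpret A: two_category A
    using assms(1) by (rule modification_two_category)
  show ?thesis
    using assms
    by (auto simp: modif_vcmp_def fun_eq_iff modification.mob_cell modification.src2_mob
        modification.tgt2_mob intro!: A.vcmp_assoc)
qed

lemma modif_sel [simp]:
  "msrc (modif_id I A \<mu>) = \<mu>" "mtgt (modif_id I A \<mu>) = \<mu>"
  "msrc (modif_vcmp I A \<psi> \<phi>) = msrc \<phi>" "mtgt (modif_vcmp I A \<psi> \<phi>) = mtgt \<psi>"
  by (simp_all add: modif_id_def modif_vcmp_def)

text \<open>The limit property involves one such hom-category at a time. \<open>F\<close> and
  \<open>G\<close> are arbitrary because a lax-natural transformation between them already makes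
  them 2-functors.\<close>

lemma category_hom_cat_Lax: "category (hom_cat (Lax I A) F G)"
  by unfold_locales
    (auto simp: hom_cat_def modification_id modification_vcmp modif_vcmp_assoc
      modification.tsrc_eq modification.ttgt_eq modification.axioms modif_vcmp_id)

section \<open>Cones over a morphism\<close>

lemma two_simps [simp]:
  "Obj two = {0, 1}" "Mor two = {(0, 0), (0, 1), (1, 1)}" "Cell two = {(0, 0), (0, 1), (1, 1)}"
  "src two = fst" "tgt two = snd" "src2 two = (\<lambda>p. p)" "tgt2 two = (\<lambda>p. p)"
  "id1 two = (\<lambda>i. (i, i))" "id2 two = (\<lambda>p. p)" "cmp1 two = (\<lambda>q p. (fst p, snd q))"
  "hcmp two = (\<lambda>q p. (fst p, snd q))" "vcmp two = (\<lambda>q p. p)"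
  by (simp_all add: two_def locally_discrete_def arrow_cat_def)

lemma Delta_ob_sel [simp]:
  "i \<in> Obj I \<Longrightarrow> fob (Delta_ob I A x) i = x"
  "g \<in> Mor I \<Longrightarrow> fmor (Delta_ob I A x) g = id1 A x"
  "a \<in> Cell I \<Longrightarrow> fcell (Delta_ob I A x) a = id2 A (id1 A x)"
  by (simp_all add: Delta_ob_def)

lemma mor_functor_sel [simp]:
  "fob (mor_functor A f) 0 = src A f" "fob (mor_functor A f) (Suc 0) = tgt A f"
  "fmor (mor_functor A f) (0, 0) = id1 A (src A f)" "fmor (mor_functor A f) (0, Suc 0) = f"
  "fmor (mor_functor A f) (Suc 0, Suc 0) = id1 A (tgt A f)"
  "fcell (mor_functor A f) (0, 0) = id2 A (id1 A (src A f))" "fcell (mor_functor A f) (0, Suc 0) = id2 A f"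
  "fcell (mor_functor A f) (Suc 0, Suc 0) = id2 A (id1 A (tgt A f))"
  by (simp_all add: mor_functor_def)

lemma two_category_two: "two_category two"
  by unfold_locales auto

context two_category
begin

lemma two_functor_Delta_ob:
  assumes "two_category I" "x \<in> Obj A"
  shows "two_functor I A (Delta_ob I A x)"
proof -
  interpret I: two_category I by fact
  show ?thesis
    using assms by unfold_locales (auto simp: Delta_ob_def unit_simps)
qed

lemma two_functor_mor_functor:
  assumes "f \<in> Mor A"
  shows "two_functor two A (mor_functor A f)"
proof -
  interpret two: two_category two by (rule two_category_two)
  show ?thesis
    using assms by unfold_locales (auto simp: mor_functor_def unit_simps)
qed

end

text \<open>Isolates what the limit half uses of the example, so that no terms of the presentation
  occur in the cone computations. The example enters by interpretation.\<close>

locale mor_into_discrete = two_category A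
  for A :: "('o, 'm, 'c) two_cat" +
  fixes f :: 'm
  assumes f_mor [simp]: "f \<in> Mor A"
    and discrete: "\<lbrakk>b \<in> Cell A; tgt A (src2 A b) = tgt A f\<rbrakk> \<Longrightarrow> b = id2 A (src2 A b)"
begin

lemma cell_eq_id2: "\<lbrakk>b \<in> Cell A; src2 A b = h; tgt A h = tgt A f\<rbrakk> \<Longrightarrow> b = id2 A h"
  using discrete by blast

lemma tgt2_discrete: "\<lbrakk>b \<in> Cell A; src2 A b = h; tgt A h = tgt A f\<rbrakk> \<Longrightarrow> tgt2 A b = h"
  using arg_cong[of _ _ "tgt2 A", OF cell_eq_id2] src2_mor by fastforce

text \<open>The composite of \<open>id_cone A f\<close> with \<open>Delta_mor two A h\<close> after
  all whiskerings are evaluated, as \<open>id_cone_Delta_mor\<close> confirms. The second branch of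
  \<open>tmor\<close> serves both the arrow from 0 to 1 and the identity of 1.\<close>

definition cone_of :: "'m \<Rightarrow> (nat, nat \<times> nat, nat \<times> nat, 'o, 'm, 'c) trans" where
  "cone_of h = \<lparr> tsrc = Delta_ob two A (src A h), ttgt = mor_functor A f,
     tob = (\<lambda>i\<in>Obj two. if i = 0 then h else cmp1 A f h),
     tmor = (\<lambda>p\<in>Mor two. if p = (0, 0) then id2 A h else id2 A (cmp1 A f h)) \<rparr>"

lemma cone_of_sel [simp]:
  "tsrc (cone_of h) = Delta_ob two A (src A h)" "ttgt (cone_of h) = mor_functor A f"
  "tob (cone_of h) 0 = h" "tob (cone_of h) (Suc 0) = cmp1 A f h"
  "tmor (cone_of h) (0, 0) = id2 A h" "tmor (cone_of h) (0, Suc 0) = id2 A (cmp1 A f h)"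
  "tmor (cone_of h) (Suc 0, Suc 0) = id2 A (cmp1 A f h)"
  by (simp_all add: cone_of_def)

lemma cone_of_ext:
  "tob (cone_of h) \<in> extensional (Obj two)" "tmor (cone_of h) \<in> extensional (Mor two)"
  by (simp_all only: cone_of_def trans.select_convs restrict_extensional)

text \<open>The component at 1 should be \<open>b\<close> whiskered with \<open>f\<close>; it is
  written as the identity that \<open>whisker_discrete\<close> shows it to be.\<close>

definition modif_of :: "'c \<Rightarrow> (nat, nat \<times> nat, nat \<times> nat, 'o, 'm, 'c) modif" where
  "modif_of b = \<lparr> msrc = cone_of (src2 A b), mtgt = cone_of (tgt2 A b),
     mob = (\<lambda>i\<in>Obj two. if i = 0 then b else id2 A (cmp1 A f (src2 A b))) \<rparr>"

lemma modif_of_sel [simp]: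
  "msrc (modif_of b) = cone_of (src2 A b)" "mtgt (modif_of b) = cone_of (tgt2 A b)"
  "mob (modif_of b) 0 = b" "mob (modif_of b) (Suc 0) = id2 A (cmp1 A f (src2 A b))"
  by (simp_all add: modif_of_def)

lemma modif_of_ext: "mob (modif_of b) \<in> extensional (Obj two)"
  by (simp only: modif_of_def modif.select_convs restrict_extensional)

lemma lax_natural_cone_of:
  assumes h: "h \<in> Mor A" "tgt A h = src A f"
  shows "lax_natural two A (cone_of h)"
proof -
  interpret D: two_functor two A "Delta_ob two A (src A h)"
    using h by (simp add: two_functor_Delta_ob two_category_two)
  interpret M: two_functor two A "mor_functor A f"
    by (simp add: two_functor_mor_functor)
  show ?thesis
    using h D.two_functor_axioms M.two_functor_axioms
    \<comment> \<open>The carriers stay folded while \<open>cone_of_ext\<close> settles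
      extensionality; unfolding them afterwards splits into the finitely many objects and arrows of
      \<open>two\<close>.\<close>
    by (intro lax_natural.intro lax_natural_axioms.intro)
      (auto simp del: two_simps(1-3) simp: cone_of_ext, auto simp: unit_simps)
qed

text \<open>The 2-morphism at the arrow from 0 to 1 starts at \<open>cmp1 A f (tob \<mu> 0)\<close>
  and ends at \<open>tob \<mu> 1\<close>. It lies over the target of \<open>f\<close>, so it is an
  identity and forces \<open>tob \<mu> 1\<close>. The unit axiom fixes the other two
  2-morphisms.\<close>

lemma lax_natural_eq_cone_of:
  assumes "lax_natural two A \<mu>" "tsrc \<mu> = Delta_ob two A x" "ttgt \<mu> = mor_functor A f"
  shows "\<mu> = cone_of (tob \<mu> 0)" "tob \<mu> 0 \<in> Mor A" "src A (tob \<mu> 0) = x" "tgt A (tob \<mu> 0) = src A f"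
proof -
  interpret lax_natural two A \<mu> by fact
  have mor: "tob \<mu> 0 \<in> Mor A" "src A (tob \<mu> 0) = x" "tgt A (tob \<mu> 0) = src A f"
    "tob \<mu> 1 \<in> Mor A" "src A (tob \<mu> 1) = x" "tgt A (tob \<mu> 1) = tgt A f"
    using tob_mor[of 0] tob_mor[of 1] src_tob[of 0] src_tob[of 1] tgt_tob[of 0] tgt_tob[of 1] assms
    by simp_all
  have cell: "tmor \<mu> (0, 1) \<in> Cell A" "src2 A (tmor \<mu> (0, 1)) = cmp1 A f (tob \<mu> 0)"
    "tgt2 A (tmor \<mu> (0, 1)) = tob \<mu> 1"
    using tmor_cell[of "(0, 1)"] src2_tmor[of "(0, 1)"] tgt2_tmor[of "(0, 1)"] assms mor
    by (simp_all add: cmp1_id_right')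
  then have tob1: "tob \<mu> 1 = cmp1 A f (tob \<mu> 0)"
    and tmor01: "tmor \<mu> (0, 1) = id2 A (cmp1 A f (tob \<mu> 0))"
    using cell_eq_id2[OF cell(1,2)] tgt2_discrete[OF cell(1,2)] mor by auto
  have "tob \<mu> = tob (cone_of (tob \<mu> 0))"
    using tob_ext cone_of_ext(1)
  proof (rule extensionalityI)
    show "tob \<mu> i = tob (cone_of (tob \<mu> 0)) i" if "i \<in> Obj two" for i
      using that tob1 by auto
  qed
  moreover have "tmor \<mu> = tmor (cone_of (tob \<mu> 0))"
    using tmor_ext cone_of_ext(2)
  proof (rule extensionalityI)
    show "tmor \<mu> p = tmor (cone_of (tob \<mu> 0)) p" if "p \<in> Mor two" for p
      using that tmor01 tob1 tmor_id1[of 0] tmor_id1[of 1] by auto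
  qed
  ultimately show "\<mu> = cone_of (tob \<mu> 0)"
    using assms mor by (intro trans.equality) simp_all
  show "tob \<mu> 0 \<in> Mor A" "src A (tob \<mu> 0) = x" "tgt A (tob \<mu> 0) = src A f"
    using mor by simp_all
qed

text \<open>Whiskering with \<open>f\<close> carries \<open>b\<close> to where all 2-morphisms are
  identities; comparing target with source there gives the first equation.\<close>

lemma whisker_discrete:
  assumes "b \<in> Cell A" "tgt A (src2 A b) = src A f"
  shows "cmp1 A f (tgt2 A b) = cmp1 A f (src2 A b)"
    and "hcmp A (id2 A f) b = id2 A (cmp1 A f (src2 A b))"
  using assms tgt2_discrete[of "hcmp A (id2 A f) b" "cmp1 A f (src2 A b)"]
  by (auto intro: cell_eq_id2)

lemma modification_modif_of:
  assumes b: "b \<in> Cell A" "tgt A (src2 A b) = src A f"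
  shows "modification two A (modif_of b)"
  using assms
  by (intro modification.intro modification_axioms.intro)
    (simp_all del: two_simps(1-3) add: modif_of_ext lax_natural_cone_of,
      auto simp: whisker_discrete unit_simps)

text \<open>The component at 1 lies over the target of \<open>f\<close>, hence is an identity, so
  evaluation at 0 loses nothing.\<close>

lemma modification_eq_modif_of:
  assumes "modification two A \<phi>"
    and "tsrc (msrc \<phi>) = Delta_ob two A x" "ttgt (msrc \<phi>) = mor_functor A f"
  shows "\<phi> = modif_of (mob \<phi> 0)" "mob \<phi> 0 \<in> Cell A"
    "src A (src2 A (mob \<phi> 0)) = x" "tgt A (src2 A (mob \<phi> 0)) = src A f"
proof -
  interpret modification two A \<phi> by fact
  note msrc = lax_natural_eq_cone_of[OF S.lax_natural_axioms assms(2,3)]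
  note mtgt = lax_natural_eq_cone_of[OF T.lax_natural_axioms, unfolded tsrc_eq ttgt_eq, OF assms(2,3)]
  have mob0: "mob \<phi> 0 \<in> Cell A" "src2 A (mob \<phi> 0) = tob (msrc \<phi>) 0"
    "tgt2 A (mob \<phi> 0) = tob (mtgt \<phi>) 0"
    using mob_cell[of 0] src2_mob[of 0] tgt2_mob[of 0] by auto
  have "tob (msrc \<phi>) 1 = tob (cone_of (tob (msrc \<phi>) 0)) 1"
    using msrc(1) by simp
  then have tob1: "tob (msrc \<phi>) 1 = cmp1 A f (tob (msrc \<phi>) 0)"
    by (simp add: cone_of_def)
  have "mob \<phi> 1 = id2 A (cmp1 A f (tob (msrc \<phi>) 0))"
    using mob_cell[of 1] src2_mob[of 1] tob1 msrc(2-4) by (intro cell_eq_id2) auto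
  then have mob: "mob \<phi> i = mob (modif_of (mob \<phi> 0)) i" if "i \<in> Obj two" for i
    using that mob0 by auto
  have "mob \<phi> = mob (modif_of (mob \<phi> 0))"
    using mob_ext modif_of_ext mob by (rule extensionalityI)
  then show "\<phi> = modif_of (mob \<phi> 0)"
    using mob0 msrc(1) mtgt(1) by (intro modif.equality) simp_all
  show "mob \<phi> 0 \<in> Cell A" "src A (src2 A (mob \<phi> 0)) = x" "tgt A (src2 A (mob \<phi> 0)) = src A f"
    using mob0 msrc(2-4) by auto
qed

lemma pseudo_natural_lax_cone:
  assumes "lax_natural two A \<mu>" "tsrc \<mu> = Delta_ob two A x" "ttgt \<mu> = mor_functor A f"
  shows "pseudo_natural two A \<mu>"
proof -
  note \<mu> = lax_natural_eq_cone_of[OF assms]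
  have "invertible_cell A (tmor (cone_of (tob \<mu> 0)) p)" if "p \<in> Mor two" for p
    using that \<mu>(2-4) by (auto simp: cone_of_def intro!: invertible_id2)
  then show ?thesis
    using assms(1) \<mu>(1) by (simp add: pseudo_natural_def)
qed

text \<open>Equality of the hom-categories, and not merely an isomorphism, lets the lax result be
  reused unchanged for pseudo-cones.\<close>

lemma hom_cat_Ps: "hom_cat (Ps two A) (Delta_ob two A x) (mor_functor A f) =
    hom_cat (Lax two A) (Delta_ob two A x) (mor_functor A f)"
proof -
  have "pseudo_natural two A \<mu> \<longleftrightarrow> lax_natural two A \<mu>"
    if "tsrc \<mu> = Delta_ob two A x" "ttgt \<mu> = mor_functor A f" for \<mu>
    using that pseudo_natural_lax_cone by (auto simp: pseudo_natural_def)
  then show ?thesis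
    by (auto simp: hom_cat_def modification.tsrc_eq modification.ttgt_eq modification.axioms)
qed

lemma id_cone_eq: "id_cone A f = cone_of (id1 A (src A f))"
  by (simp add: id_cone_def cone_of_def cmp1_id_right[OF f_mor] cong: if_cong)

text \<open>Together with \<open>id_cone_Delta_cell\<close>, this replaces post-composition by
  explicit formulas for which functoriality and inverses are easy to check.\<close>

lemma id_cone_Delta_mor:
  assumes "h \<in> Mor A" "tgt A h = src A f"
  shows "trans_cmp two A (id_cone A f) (Delta_mor two A h) = cone_of h"
proof -
  have "tob (trans_cmp two A (id_cone A f) (Delta_mor two A h)) = tob (cone_of h)"
    unfolding trans_cmp_def cone_of_def trans.select_convs
    by (rule restrict_ext) (use assms in \<open>auto simp: id_cone_def Delta_mor_def unit_simps\<close>)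
  moreover have "tmor (trans_cmp two A (id_cone A f) (Delta_mor two A h)) = tmor (cone_of h)"
    unfolding trans_cmp_def cone_of_def trans.select_convs
    by (rule restrict_ext) (use assms in \<open>auto simp: id_cone_def Delta_mor_def unit_simps\<close>)
  ultimately show ?thesis
    by (intro trans.equality) (simp_all add: trans_cmp_def id_cone_def Delta_mor_def)
qed

lemma id_cone_Delta_cell:
  assumes "b \<in> Cell A" "tgt A (src2 A b) = src A f"
  shows "modif_hcmp two A (modif_id two A (id_cone A f)) (Delta_cell two A b) = modif_of b"
proof -
  have "mob (modif_hcmp two A (modif_id two A (id_cone A f)) (Delta_cell two A b)) = mob (modif_of b)"
    unfolding modif_hcmp_def modif_of_def modif.select_convs
    by (rule restrict_ext)
      (use assms in \<open>auto simp: id_cone_def modif_id_def Delta_cell_def unit_simps whisker_discrete\<close>)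
  with assms show ?thesis
    by (intro modif.equality)
      (simp_all add: modif_hcmp_def modif_id_def Delta_cell_def id_cone_Delta_mor)
qed

lemma modif_of_id2:
  assumes "h \<in> Mor A"
  shows "modif_of (id2 A h) = modif_id two A (cone_of h)"
proof -
  have "mob (modif_of (id2 A h)) = mob (modif_id two A (cone_of h))"
    unfolding modif_id_def modif_of_def modif.select_convs
    by (rule restrict_ext) (use assms in auto)
  with assms show ?thesis
    by (intro modif.equality) simp_all
qed

lemma modif_of_vcmp:
  assumes "b \<in> Cell A" "a \<in> Cell A" "src2 A b = tgt2 A a" "tgt A (src2 A a) = src A f"
  shows "modif_of (vcmp A b a) = modif_vcmp two A (modif_of b) (modif_of a)"
proof -
  have "mob (modif_of (vcmp A b a)) = mob (modif_vcmp two A (modif_of b) (modif_of a))"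
    unfolding modif_vcmp_def modif_of_def modif.select_convs
    by (rule restrict_ext) (use assms in \<open>auto simp: unit_simps whisker_discrete\<close>)
  with assms show ?thesis
    by (intro modif.equality) simp_all
qed

section \<open>Post-composition as an isomorphism of hom-categories\<close>

lemma cat_functor_cone_of:
  "cat_functor (hom_cat A x (src A f))
     (hom_cat (Lax two A) (Delta_ob two A x) (mor_functor A f)) cone_of modif_of"
  by (intro cat_functor.intro cat_functor_axioms.intro category_hom_cat category_hom_cat_Lax)
    (auto simp: hom_cat_def lax_natural_cone_of modification_modif_of modif_of_id2 modif_of_vcmp)

text \<open>Evaluation at 0 will be the inverse of post-composition.\<close>

lemma cat_functor_component:
  "cat_functor (hom_cat (Lax two A) (Delta_ob two A x) (mor_functor A f))
     (hom_cat A x (src A f)) (\<lambda>\<mu>. tob \<mu> 0) (\<lambda>\<phi>. mob \<phi> 0)"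
  by (intro cat_functor.intro cat_functor_axioms.intro category_hom_cat category_hom_cat_Lax)
    (auto simp: hom_cat_def modif_id_def modif_vcmp_def lax_natural_eq_cone_of(2-)
      modification_eq_modif_of(2-) modification.src2_mob modification.tgt2_mob)

lemma iso_functor_id_cone:
  "iso_functor (hom_cat A x (src A f))
     (hom_cat (Lax two A) (Delta_ob two A x) (mor_functor A f))
     (\<lambda>h. trans_cmp two A (id_cone A f) (Delta_mor two A h))
     (\<lambda>b. modif_hcmp two A (modif_id two A (id_cone A f)) (Delta_cell two A b))"
proof -
  let ?C = "hom_cat A x (src A f)"
    and ?D = "hom_cat (Lax two A) (Delta_ob two A x) (mor_functor A f)"
  let ?G0 = "\<lambda>h. trans_cmp two A (id_cone A f) (Delta_mor two A h)"
    and ?G1 = "\<lambda>b. modif_hcmp two A (modif_id two A (id_cone A f)) (Delta_cell two A b)"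
  interpret K: cat_functor ?C ?D cone_of modif_of
    by (rule cat_functor_cone_of)
  interpret H: cat_functor ?D ?C "\<lambda>\<mu>. tob \<mu> 0" "\<lambda>\<phi>. mob \<phi> 0"
    by (rule cat_functor_component)
  have G0: "?G0 h = cone_of h" if "h \<in> cOb ?C" for h
    using that by (simp add: hom_cat_def id_cone_Delta_mor)
  have G1: "?G1 b = modif_of b" if "b \<in> cArr ?C" for b
    using that by (simp add: hom_cat_def id_cone_Delta_cell)
  \<comment> \<open>Post-composition is known to agree with \<open>cone_of\<close> and
    \<open>modif_of\<close> on the carriers, so functoriality is transferred clause by
    clause.\<close>
  have "cat_functor ?C ?D ?G0 ?G1"
    by (intro cat_functor.intro cat_functor_axioms.intro K.C.category_axioms K.D.category_axioms)
      (simp_all add: G0 G1 K.C.dom_ob K.C.cod_ob K.C.id_arr K.C.cmp_arr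
        K.map_ob K.map_arr K.map_dom K.map_cod K.map_id K.map_cmp)
  moreover have "cone_of (tob \<mu> 0) = \<mu>" if "\<mu> \<in> cOb ?D" for \<mu>
    using that by (auto simp: hom_cat_def intro: lax_natural_eq_cone_of(1)[symmetric])
  moreover have "modif_of (mob \<phi> 0) = \<phi>" if "\<phi> \<in> cArr ?D" for \<phi>
    using that by (auto simp: hom_cat_def intro: modification_eq_modif_of(1)[symmetric])
  ultimately show ?thesis
    unfolding iso_functor_def
    using H.cat_functor_axioms H.map_ob H.map_arr
    by (intro conjI exI[of _ "\<lambda>\<mu>. tob \<mu> 0"] exI[of _ "\<lambda>\<phi>. mob \<phi> 0"]) (auto simp: G0 G1)
qed

theorem lax_limit_id_cone:
  "lax_limit two A (mor_functor A f) (src A f, id_cone A f)"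
  unfolding is_limit_def is_cone_def
  by (simp add: id_cone_eq lax_natural_cone_of iso_functor_id_cone[unfolded id_cone_eq])

theorem pseudo_limit_id_cone:
  "pseudo_limit two A (mor_functor A f) (src A f, id_cone A f)"
proof -
  have "pseudo_natural two A (id_cone A f)"
    using pseudo_natural_lax_cone[of "id_cone A f"]
    by (simp add: id_cone_eq lax_natural_cone_of)
  then show ?thesis
    using lax_limit_id_cone unfolding is_limit_def is_cone_def
    by (simp add: hom_cat_Ps)
qed

end

section \<open>Limits that are not 2-terminal\<close>

text \<open>Functors preserve isomorphisms, and the isomorphisms of a hom-category are invertible
  2-morphisms. \<open>T\<close> enters only through a hom-category.\<close>

lemma cat_functor_invertible_cell:
  assumes "two_category A" "cat_functor (hom_cat A x y) (hom_cat T u v) G0 G1"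
    and "invertible_cell A a" "src A (src2 A a) = x" "tgt A (src2 A a) = y"
  shows "invertible_cell T (G1 a)"
proof -
  interpret A: two_category A by fact
  interpret G: cat_functor "hom_cat A x y" "hom_cat T u v" G0 G1 by fact
  obtain b where b: "b \<in> Cell A" "src2 A b = tgt2 A a" "tgt2 A b = src2 A a"
      "vcmp A b a = id2 A (src2 A a)" "vcmp A a b = id2 A (tgt2 A a)" and a: "a \<in> Cell A"
    using assms(3) unfolding invertible_cell_def by blast
  have arr: "a \<in> cArr (hom_cat A x y)" "b \<in> cArr (hom_cat A x y)"
    and ob: "src2 A a \<in> cOb (hom_cat A x y)" "tgt2 A a \<in> cOb (hom_cat A x y)"
    using a b assms(4,5) by (simp_all add: hom_cat_def)
  have "vcmp T (G1 b) (G1 a) = id2 T (G0 (src2 A a))" "vcmp T (G1 a) (G1 b) = id2 T (G0 (tgt2 A a))"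
    using G.map_cmp[of b a] G.map_cmp[of a b] G.map_id arr ob b by (simp_all add: hom_cat_def)
  moreover have "src2 T (G1 a) = G0 (src2 A a)" "tgt2 T (G1 a) = G0 (tgt2 A a)"
    "src2 T (G1 b) = G0 (tgt2 A a)" "tgt2 T (G1 b) = G0 (src2 A a)"
    using G.map_dom G.map_cod arr b by (simp_all add: hom_cat_def)
  moreover have "G1 a \<in> Cell T" "G1 b \<in> Cell T"
    using G.map_arr arr by (simp_all add: hom_cat_def)
  ultimately show ?thesis
    unfolding invertible_cell_def by force
qed

text \<open>The inverse functor sends the single object \<open>()\<close> back to both
  \<open>x\<close> and \<open>y\<close>.\<close>

lemma isomorphic_terminal_unique:
  assumes "isomorphic_cat C terminal_cat" "x \<in> cOb C" "y \<in> cOb C"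
  shows "x = y"
  using assms unfolding isomorphic_cat_def iso_functor_def by (metis old.unit.exhaust)

text \<open>
  An invertible \<open>a : k \<Rightarrow> h\<close> yields two slice morphisms into the limit from the cone induced by
  \<open>h\<close>: one with leg \<open>h\<close> and an identity modification, one with leg \<open>k\<close> and the image of \<open>a\<close>.
\<close>

theorem limit_not_two_terminal:
  assumes A: "two_category A" and lim: "is_limit T I A F (l, \<kappa>)"
    and a: "invertible_cell A a" "tgt A (src2 A a) = l" "src2 A a \<noteq> tgt2 A a"
  shows "\<not> two_terminal (pseudo_slice T I A F) (l, \<kappa>)"
proof
  interpret A: two_category A by fact
  let ?S = "pseudo_slice T I A F"
  define x where "x = src A (src2 A a)"
  define h where "h = tgt2 A a"
  define k where "k = src2 A a"
  define \<mu> where "\<mu> = cmp1 T \<kappa> (Delta_mor I A h)"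
  let ?G0 = "\<lambda>h. cmp1 T \<kappa> (Delta_mor I A h)" and ?G1 = "\<lambda>b. hcmp T (id2 T \<kappa>) (Delta_cell I A b)"
  have a_cell: "a \<in> Cell A"
    using a(1) by (simp add: invertible_cell_def)
  then have x: "x \<in> Obj A" and h: "h \<in> Mor A" "src A h = x" "tgt A h = l"
    and k: "k \<in> Mor A" "src A k = x" "tgt A k = l"
    using a(2) by (simp_all add: x_def h_def k_def)
  have cone: "is_cone T I A F (l, \<kappa>)"
    and G: "cat_functor (hom_cat A x l) (hom_cat T (Delta_ob I A x) F) ?G0 ?G1"
    using lim x unfolding is_limit_def iso_functor_def by blast+
  interpret G: cat_functor "hom_cat A x l" "hom_cat T (Delta_ob I A x) F" ?G0 ?G1 by (rule G)
  have cone_\<mu>: "is_cone T I A F (x, \<mu>)"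
    using G.map_ob[of h] h x by (simp add: hom_cat_def is_cone_def \<mu>_def)
  have inv: "invertible_cell T (?G1 (id2 A h))" "invertible_cell T (?G1 a)"
    using cat_functor_invertible_cell[OF A G] A.invertible_id2 a h by (simp_all add: x_def)
  have bd: "src2 T (?G1 b) = ?G0 (src2 A b)" "tgt2 T (?G1 b) = ?G0 (tgt2 A b)"
    if "b \<in> Cell A" "src A (src2 A b) = x" "tgt A (src2 A b) = l" for b
    using G.map_dom[of b] G.map_cod[of b] that by (simp_all add: hom_cat_def)
  \<comment> \<open>The modification is the image of \<open>id2 A h\<close>, so that its
    invertibility and boundary come from the functor \<open>G\<close>, just as for
    \<open>q\<close>.\<close>
  define p where "p = \<lparr> sdom = (x, \<mu>), scod = (l, \<kappa>), sleg = h, smod = ?G1 (id2 A h) \<rparr>"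
  \<comment> \<open>A slice modification runs from the composite with the leg to the given cone;
    \<open>a\<close> runs from \<open>k\<close> to \<open>h\<close>, so its image fits the leg
    \<open>k\<close> and the cone \<open>\<mu>\<close>.\<close>
  define q where "q = \<lparr> sdom = (x, \<mu>), scod = (l, \<kappa>), sleg = k, smod = ?G1 a \<rparr>"
  have "is_slice_mor T I A F p"
    using cone cone_\<mu> h inv(1) bd[of "id2 A h"] by (simp add: is_slice_mor_def p_def \<mu>_def)
  moreover have "is_slice_mor T I A F q"
    using cone cone_\<mu> k inv(2) bd[of a] a_cell a(2)
    by (simp add: is_slice_mor_def q_def \<mu>_def x_def[symmetric] h_def k_def)
  ultimately have "p \<in> cOb (hom_cat ?S (x, \<mu>) (l, \<kappa>))" "q \<in> cOb (hom_cat ?S (x, \<mu>) (l, \<kappa>))"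
    by (simp_all add: hom_cat_def pseudo_slice_def p_def q_def)
  moreover assume "two_terminal ?S (l, \<kappa>)"
  then have "isomorphic_cat (hom_cat ?S (x, \<mu>) (l, \<kappa>)) terminal_cat"
    using cone_\<mu> by (simp add: two_terminal_def pseudo_slice_def)
  ultimately have "p = q"
    by (metis isomorphic_terminal_unique)
  then show False
    using a(3) by (simp add: p_def q_def h_def k_def)
qed

section \<open>The example\<close>

lemma exP_simps [simp]:
  "gob exP = {ObX, ObA, ObB}" "gmor exP = {Alpha0, Alpha1, MorF}" "gcell exP = {Alpha}" "ginv exP = {Alpha}"
  "gsrc exP Alpha0 = ObX" "gsrc exP Alpha1 = ObX" "gsrc exP MorF = ObA"
  "gtgt exP Alpha0 = ObA" "gtgt exP Alpha1 = ObA" "gtgt exP MorF = ObB"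
  "gsrc2 exP c = Gen1 Alpha0" "gtgt2 exP c = Gen1 Alpha1"
  by (simp_all add: exP_def)

interpretation exA: two_category exA
  unfolding exA_def by (rule two_category_generated)

text \<open>The only generator out of A is f and none starts at B. Both claims are proved in one
  induction, since the outer factor of a composite out of A may start at B.\<close>

lemma eq1_from_A_or_B:
  assumes "ok1 exP t"
  shows "dom1 exP t = ObA \<Longrightarrow>
      cod1 exP t = ObA \<and> eq1 exP t (Id1 ObA) \<or> cod1 exP t = ObB \<and> eq1 exP t (Gen1 MorF)"
    and "dom1 exP t = ObB \<Longrightarrow> cod1 exP t = ObB \<and> eq1 exP t (Id1 ObB)"
  using assms
proof (induction t)
  case (Id1 x)
  {
    case 1
    then show ?case by (auto intro: refl1)
  next
    case 2
    then show ?case by (auto intro: refl1)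
  }
next
  case (Gen1 g)
  {
    case 1
    then show ?case by (cases g) (auto intro: refl1)
  next
    case 2
    then show ?case by (cases g) auto
  }
next
  case (Cmp1 t s)
  {
    case 1
    then have ok: "ok1 exP t" "ok1 exP s" "dom1 exP t = cod1 exP s" "dom1 exP s = ObA" by auto
    \<comment> \<open>The inner factor decides where \<open>t\<close> starts: either
      \<open>s\<close> is trivial and \<open>t\<close> starts at A, or \<open>s\<close> is f and
      \<open>t\<close> is trivial.\<close>
    consider "cod1 exP s = ObA" "eq1 exP s (Id1 ObA)" | "cod1 exP s = ObB" "eq1 exP s (Gen1 MorF)"
      using Cmp1.IH(3) ok by blast
    then show ?case
    proof cases
      case 1
      then have "eq1 exP (Cmp1 t s) (Cmp1 t (Id1 (dom1 exP t)))"
        using ok by (auto intro: cong1 refl1)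
      then have "eq1 exP (Cmp1 t s) t"
        using ok right_id1 trans1 by blast
      then show ?thesis using Cmp1.IH(1) ok 1(1) by (auto intro: trans1)
    next
      case 2
      then have t: "cod1 exP t = ObB" "eq1 exP t (Id1 ObB)"
        using Cmp1.IH(2) ok by auto
      then have "eq1 exP (Cmp1 t s) (Cmp1 (Id1 (cod1 exP (Gen1 MorF))) (Gen1 MorF))"
        using 2 ok by (auto intro: cong1)
      then have "eq1 exP (Cmp1 t s) (Gen1 MorF)"
        using left_id1[of exP "Gen1 MorF"] trans1 by (metis exP_simps(1,2,7,10) insertCI ok1.simps(2))
      then show ?thesis using t by simp
    qed
  next
    case 2
    then have ok: "ok1 exP t" "ok1 exP s" "dom1 exP t = cod1 exP s" "dom1 exP s = ObB" by auto
    then have s: "cod1 exP s = ObB" "eq1 exP s (Id1 ObB)"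
      using Cmp1.IH(4) by auto
    then have t: "cod1 exP t = ObB" "eq1 exP t (Id1 ObB)"
      using Cmp1.IH(2) ok by auto
    have "eq1 exP (Cmp1 t s) (Cmp1 t (Id1 (dom1 exP t)))"
      using ok s by (auto intro: cong1 refl1)
    then have "eq1 exP (Cmp1 t s) t"
      using ok right_id1 trans1 by blast
    then show ?case using t by (auto intro: trans1)
  }
qed

lemma exf_simps [simp]: "exf \<in> Mor exA" "src exA exf = ObA" "tgt exA exf = ObB"
  by (simp_all add: exA_def exf_def)

text \<open>This leaves f as the only case to examine when a morphism out of A is whiskered with
  alpha or its inverse.\<close>

lemma exf_unique:
  assumes "g \<in> Mor exA" "src exA g = ObA" "tgt exA g \<noteq> ObA"
  shows "g = exf"
  using assms eq1_from_A_or_B(1) unfolding exA_def exf_def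
  by (elim Mor_generatedE) (auto simp: cls1_eq_iff)

section \<open>Whiskering trivializes 2-morphisms away from A\<close>

lemma exf_whisker_gen:
  assumes "ok2 exP (Gen2 c)"
  shows "hcmp exA (id2 exA exf) (cls2 exP (Gen2 c)) = id2 exA (cmp1 exA exf (src2 exA (cls2 exP (Gen2 c))))"
proof -
  have "c = Alpha" by (cases c)
  have "eq2 exP (Hcmp (Id2 (Gen1 MorF)) (Gen2 c)) (Id2 (Cmp1 (Gen1 MorF) (Gen1 Alpha0)))"
    \<comment> \<open>The imposed relation applies only between 2-terms with equal boundaries; for
      the targets this is the relation between f alpha_0 and f alpha_1.\<close>
    by (rule eq2.rel2)
      (auto simp: \<open>c = Alpha\<close> intro: refl1, auto simp: exP_def intro!: sym1[OF eq1.rel1])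
  with assms show ?thesis
    by (simp add: exA_def exf_def cls2_eq_iff)
qed

text \<open>No relation mentions the formal inverse. Whiskering alpha composed with its inverse
  gives an identity, and the factor coming from alpha is already an identity.\<close>

lemma exf_whisker_inv:
  assumes "ok2 exP (Inv2 c)"
  shows "hcmp exA (id2 exA exf) (cls2 exP (Inv2 c)) = id2 exA (cmp1 exA exf (src2 exA (cls2 exP (Inv2 c))))"
proof -
  define a where "a = cls2 exP (Gen2 c)"
  define a' where "a' = cls2 exP (Inv2 c)"
  have ok: "ok2 exP (Gen2 c)" using assms by simp
  have bd: "a \<in> Cell exA" "a' \<in> Cell exA" "src2 exA a = tgt2 exA a'" "tgt2 exA a = src2 exA a'"
      "tgt exA (src2 exA a') = ObA"
    using assms by (simp_all add: a_def a'_def exA_def)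
  have inv: "vcmp exA a a' = id2 exA (src2 exA a')"
    using assms inv_right2[OF assms] by (simp add: a_def a'_def exA_def cls2_eq_iff refl1)
  have "hcmp exA (id2 exA exf) a' =
      vcmp exA (id2 exA (cmp1 exA exf (src2 exA a))) (hcmp exA (id2 exA exf) a')"
    using bd by (simp add: exA.unit_simps)
  also have "\<dots> = vcmp exA (hcmp exA (id2 exA exf) a) (hcmp exA (id2 exA exf) a')"
    using exf_whisker_gen[OF ok] by (simp add: a_def)
  also have "\<dots> = hcmp exA (id2 exA exf) (vcmp exA a a')"
    using bd by (subst exA.whisker_left_vcmp) simp_all
  also have "\<dots> = id2 exA (cmp1 exA exf (src2 exA a'))"
    using bd by (simp add: inv)
  finally show ?thesis by (simp add: a'_def)
qed

lemmas exA_cell_induct [consumes 1, case_names id2 gen inv vcmp hcmp] =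
  Cell_generated_induct[where P = exP, folded exA_def]

text \<open>Quantifying over all \<open>g\<close> out of the target makes the case of a horizontal composite go through.\<close>

lemma whisker_into_non_A:
  assumes "b \<in> Cell exA" "g \<in> Mor exA" "src exA g = tgt exA (src2 exA b)" "tgt exA g \<noteq> ObA"
  shows "hcmp exA (id2 exA g) b = id2 exA (cmp1 exA g (src2 exA b))"
  using assms
proof (induction b arbitrary: g rule: exA_cell_induct)
  case (id2 f)
  then show ?case by simp
next
  case (gen c)
  then have "src exA g = ObA" by (simp add: exA_def)
  with gen show ?case
    using exf_unique exf_whisker_gen[OF gen(1)] by blast
next
  case (inv c)
  then have "src exA g = ObA" by (simp add: exA_def)
  with inv show ?case
    using exf_unique exf_whisker_inv[OF inv(1)] by blast
next
  case (vcmp b a)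
  have b: "hcmp exA (id2 exA g) b = id2 exA (cmp1 exA g (src2 exA b))"
    and a: "hcmp exA (id2 exA g) a = id2 exA (cmp1 exA g (src2 exA a))"
    using vcmp by simp_all
  \<comment> \<open>The identity found for \<open>a\<close> has equal source and target; hence the
    two identities being composed are the same one.\<close>
  have "cmp1 exA g (tgt2 exA a) = cmp1 exA g (src2 exA a)"
    using arg_cong[OF a, of "tgt2 exA"] vcmp.hyps vcmp.prems by simp
  with a b vcmp show ?case
    by (simp add: exA.whisker_left_vcmp exA.unit_simps)
next
  case (hcmp b a)
  have "hcmp exA (id2 exA g) (hcmp exA b a) = hcmp exA (hcmp exA (id2 exA g) b) a"
    using hcmp.hyps hcmp.prems by (simp add: exA.hcmp_assoc)
  also have "\<dots> = hcmp exA (id2 exA (cmp1 exA g (src2 exA b))) a"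
    using hcmp by simp
  \<comment> \<open>The induction hypothesis for \<open>a\<close> is used with
    \<open>cmp1 exA g (src2 exA b)\<close>, which has the same target as \<open>g\<close> and so
    again avoids A.\<close>
  also have "\<dots> = id2 exA (cmp1 exA (cmp1 exA g (src2 exA b)) (src2 exA a))"
    using hcmp by simp
  finally show ?case
    using hcmp by (simp add: exA.cmp1_assoc)
qed

interpretation exA: mor_into_discrete exA exf
proof
  fix b assume b: "b \<in> Cell exA" "tgt exA (src2 exA b) = tgt exA exf"
  then show "b = id2 exA (src2 exA b)"
    \<comment> \<open>Whiskering with the identity of B leaves \<open>b\<close> unchanged.\<close>
    using whisker_into_non_A[of b "id1 exA (tgt exA exf)"] exA.tgt_ob[of exf]
    by (simp add: exA.unit_simps)
qed simp

text \<open>A model separating \<open>\<alpha>\<^sub>0\<close> from \<open>\<alpha>\<^sub>1\<close>.\<close>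

fun bool_action :: "('o, gen_mor) tm1 \<Rightarrow> bool \<Rightarrow> bool" where
  "bool_action (Id1 x) = id"
| "bool_action (Gen1 g) = (\<lambda>_. g = Alpha1)"
| "bool_action (Cmp1 t s) = bool_action t \<circ> bool_action s"

text \<open>Alpha_1 acts as constantly true, alpha_0 and f as constantly false. Since f is constant,
  f alpha_0 and f alpha_1 act alike, so the one imposed relation on morphisms holds.\<close>

lemma bool_action_eq1: "eq1 exP s t \<Longrightarrow> bool_action s = bool_action t"
  by (induction rule: eq1.induct) (auto simp: exP_def fun_eq_iff)

lemma alpha:
  defines "a \<equiv> cls2 exP (Gen2 Alpha)"
  shows "invertible_cell exA a" "tgt exA (src2 exA a) = ObA" "src2 exA a \<noteq> tgt2 exA a"
proof -
  have "bool_action (Gen1 Alpha0) \<noteq> bool_action (Gen1 Alpha1)"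
    by (simp add: fun_eq_iff)
  then have "\<not> eq1 exP (Gen1 Alpha0) (Gen1 Alpha1)"
    using bool_action_eq1 by blast
  then show "src2 exA a \<noteq> tgt2 exA a" "tgt exA (src2 exA a) = ObA"
    by (simp_all add: a_def exA_def cls1_eq_iff)
  have "vcmp exA (cls2 exP (Inv2 Alpha)) a = id2 exA (src2 exA a)"
    "vcmp exA a (cls2 exP (Inv2 Alpha)) = id2 exA (tgt2 exA a)"
    using inv_left2[of exP Alpha] inv_right2[of exP Alpha]
    by (simp_all add: a_def exA_def cls2_eq_iff refl1)
  then show "invertible_cell exA a"
    unfolding invertible_cell_def
    by (intro conjI bexI[of _ "cls2 exP (Inv2 Alpha)"]) (simp_all add: a_def exA_def)
qed

theorem mainTheorem15:
  shows "lax_limit two exA (mor_functor exA exf) (ObA, id_cone exA exf)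
       \<and> \<not> two_terminal (lax_cone_slice two exA (mor_functor exA exf)) (ObA, id_cone exA exf)
       \<and> pseudo_limit two exA (mor_functor exA exf) (ObA, id_cone exA exf)
       \<and> \<not> two_terminal (pseudo_cone_slice two exA (mor_functor exA exf)) (ObA, id_cone exA exf)"
  \<comment> \<open>\<open>limit_not_two_terminal\<close> serves twice, with \<open>T\<close> the
    lax and the pseudo 2-category, each time with the generating 2-morphism from alpha_0 to
    alpha_1.\<close>
  using exA.lax_limit_id_cone exA.pseudo_limit_id_cone
    limit_not_two_terminal[OF exA.two_category_axioms _ alpha] unfolding exf_simps
  by blast

end
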